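(* Fix an integer $n \ge 1$. For every face $D$ of the wiggly complex (i.e. every set $D$ of pairwise compatible internal wiggly arcs), the vectors $\mathbf{g}(\alpha)$, $\alpha \in D$, are linearly independent, and the collection of cones $\mathbb{R}_{\ge 0}\,\mathbf{g}(D) = \{\sum_{\alpha\in D}\lambda_\alpha \mathbf{g}(\alpha) : \lambda_\alpha \ge 0\}$, for all faces $D$ of the wiggly complex, forms a complete simplicial fan of the hyperplane $\mathbb{H}_{2n}=\{\mathbf{x}\in\mathbb{R}^{2n} : \sum_{k} x_k = 0\}$ (the wiggly fan).
   Context: Consider the $n+2$ points $0,1,\dots,n+1$ on the horizontal axis. A wiggly arc is a quadruple $\alpha=(i,j,A,B)$ with $0\le i<j\le n+1$ and $A,B$ a partition of $\{i+1,\dots,j-1\}$; it is represented by an abscissa-monotone curve from point $i$ to point $j$ passing above the points of $A$ and below the points of $B$. The external wiggly arcs are $(0,n+1,[n],\varnothing)$ and $(0,n+1,\varnothing,[n])$; all others are internal. Two wiggly arcs $(i,j,A,B)$ and $(i',j',A',B')$ are non pointed if $i=j'$ or $i'=j$; they are crossing if $(A\cap B')\cup(\{i,j\}\cap B')\cup(A\cap\{i',j'\})\ne\varnothing$ and $(A'\cap B)\cup(\{i',j'\}\cap B)\cup(A'\cap\{i,j\})\ne\varnothing$; they are compatible if they are neither non pointed nor crossing. The wiggly complex is the simplicial complex whose faces are the sets of pairwise compatible internal wiggly arcs. For a wiggly arc $\alpha=(i,j,A,B)$ let $\alpha^+=(\{2i-1,2j\}\setminus\{-1,2n+2\})\cup\{2a-1,2a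 : a\in A\}$ and $\alpha^-=(\{2i,2j-1\}\setminus\{0,2n+1\})\cup\{2b-1,2b : b\in B\}$, let $\hat{\mathbf{g}}(\alpha)=\mathbf{1}_{\alpha^+}-\mathbf{1}_{\alpha^-}\in\mathbb{R}^{2n}$ (where $\mathbf{1}_X=\sum_{x\in X}\mathbf{e}_x$), and let the $\mathbf{g}$-vector be $\mathbf{g}(\alpha)=\pi(\hat{\mathbf{g}}(\alpha))$, where $\pi(\mathbf{x})=\mathbf{x}-\frac{\langle \mathbf{x},\mathbf{1}_{2n}\rangle}{2n}\mathbf{1}_{2n}$ is the orthogonal projection onto $\mathbb{H}_{2n}$. For a set $D$ of wiggly arcs, $\mathbf{g}(D)=\{\mathbf{g}(\alpha):\alpha\in D \text{ internal}\}$. *)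

theory Defs
  imports "HOL-Analysis.Analysis"
begin

section \<open>The wiggly complex\<close>

type_synonym arc = "nat \<times> nat \<times> nat set \<times> nat set"

definition wiggly_arcs :: "nat \<Rightarrow> arc set" where
  "wiggly_arcs n =
    {(i, j, A, B). i < j \<and> j \<le> n + 1 \<and> A \<union> B = {i<..<j} \<and> A \<inter> B = {}}"

definition external_arcs :: "nat \<Rightarrow> arc set" where
  "external_arcs n = {(0, n + 1, {1..n}, {}), (0, n + 1, {}, {1..n})}"

definition internal_arcs :: "nat \<Rightarrow> arc set" where
  "internal_arcs n = wiggly_arcs n - external_arcs n"

fun non_pointed :: "arc \<Rightarrow> arc \<Rightarrow> bool" where
  "non_pointed (i, j, A, B) (i', j', A', B') \<longleftrightarrow> i = j' \<or> i' = j"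

fun crossing :: "arc \<Rightarrow> arc \<Rightarrow> bool" where
  "crossing (i, j, A, B) (i', j', A', B') \<longleftrightarrow>
     (A \<inter> B') \<union> ({i, j} \<inter> B') \<union> (A \<inter> {i', j'}) \<noteq> {} \<and>
     (A' \<inter> B) \<union> ({i', j'} \<inter> B) \<union> (A' \<inter> {i, j}) \<noteq> {}"

definition compatible :: "arc \<Rightarrow> arc \<Rightarrow> bool" where
  "compatible \<alpha> \<beta> \<longleftrightarrow> \<not> non_pointed \<alpha> \<beta> \<and> \<not> crossing \<alpha> \<beta>"

text \<open>The set of faces of the wiggly complex. No arc is non pointed or crossing with itself,
  so it is immaterial that \<^const>\<open>pairwise\<close> only looks at distinct arcs.\<close>

definition wiggly_complex :: "nat \<Rightarrow> arc set set" where
  "wiggly_complex n = {D. D \<subseteq> internal_arcs n \<and> pairwise compatible D}"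


section \<open>The g-vectors\<close>

text \<open>For \<open>i = 0\<close> the truncated difference \<open>2 * i - 1\<close> is \<open>0\<close> rather than \<open>-1\<close>; it is
  discarded by removing \<open>0\<close>, which is otherwise never of the form \<open>2 * i - 1\<close> or \<open>2 * j\<close>.\<close>

fun arc_plus :: "nat \<Rightarrow> arc \<Rightarrow> nat set" where
  "arc_plus n (i, j, A, B) =
     ({2 * i - 1, 2 * j} - {0, 2 * n + 2}) \<union> (\<Union>a\<in>A. {2 * a - 1, 2 * a})"

fun arc_minus :: "nat \<Rightarrow> arc \<Rightarrow> nat set" where
  "arc_minus n (i, j, A, B) =
     ({2 * i, 2 * j - 1} - {0, 2 * n + 1}) \<union> (\<Union>b\<in>B. {2 * b - 1, 2 * b})"

text \<open>The space of dimension \<open>2 * n\<close> is an arbitrary Euclidean space \<open>'a\<close> whose standard basis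
  is enumerated as \<open>e 1, \<dots>, e (2 * n)\<close>, so that the \<open>k\<close>-th coordinate of \<open>x\<close> is \<open>x \<bullet> e k\<close>.\<close>

definition char_vec :: "(nat \<Rightarrow> 'a::euclidean_space) \<Rightarrow> nat set \<Rightarrow> 'a" where
  "char_vec e X = (\<Sum>x\<in>X. e x)"

definition sum_zero_hyperplane :: "nat \<Rightarrow> (nat \<Rightarrow> 'a::euclidean_space) \<Rightarrow> 'a set" where
  "sum_zero_hyperplane n e = {x. (\<Sum>k = 1..2 * n. x \<bullet> e k) = 0}"

definition proj_sum_zero :: "nat \<Rightarrow> (nat \<Rightarrow> 'a::euclidean_space) \<Rightarrow> 'a \<Rightarrow> 'a" where
  "proj_sum_zero n e x =
     x - ((x \<bullet> char_vec e {1..2 * n}) / real (2 * n)) *\<^sub>R char_vec e {1..2 * n}"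

definition g_vec :: "nat \<Rightarrow> (nat \<Rightarrow> 'a::euclidean_space) \<Rightarrow> arc \<Rightarrow> 'a" where
  "g_vec n e \<alpha> =
     proj_sum_zero n e (char_vec e (arc_plus n \<alpha>) - char_vec e (arc_minus n \<alpha>))"

definition wiggly_cone :: "nat \<Rightarrow> (nat \<Rightarrow> 'a::euclidean_space) \<Rightarrow> arc set \<Rightarrow> 'a set" where
  "wiggly_cone n e D =
     {(\<Sum>\<alpha>\<in>D. c \<alpha> *\<^sub>R g_vec n e \<alpha>) | c :: arc \<Rightarrow> real. \<forall>\<alpha>\<in>D. 0 \<le> c \<alpha>}"


section \<open>Fans\<close>

definition polyhedral_cone :: "'a::euclidean_space set \<Rightarrow> bool" where
  "polyhedral_cone C \<longleftrightarrow> (\<exists>S. finite S \<and> C = convex_cone hull S)"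

definition simplicial_cone :: "'a::euclidean_space set \<Rightarrow> bool" where
  "simplicial_cone C \<longleftrightarrow> (\<exists>S. finite S \<and> independent S \<and> C = convex_cone hull S)"

text \<open>The faces of a cone are its intersections with its supporting hyperplanes; as
  \<^const>\<open>exposed_face_of\<close> also admits the empty set, this is excluded explicitly.\<close>

definition cone_face_of :: "'a::euclidean_space set \<Rightarrow> 'a set \<Rightarrow> bool" where
  "cone_face_of F C \<longleftrightarrow> F exposed_face_of C \<and> F \<noteq> {}"

definition fan :: "'a::euclidean_space set set \<Rightarrow> bool" where
  "fan \<F> \<longleftrightarrow>
     finite \<F> \<and>
     (\<forall>C\<in>\<F>. polyhedral_cone C) \<and>
     (\<forall>C\<in>\<F>. \<forall>F. cone_face_of F C \<longrightarrow> F \<in> \<F>) \<and>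
     (\<forall>C\<in>\<F>. \<forall>C'\<in>\<F>. cone_face_of (C \<inter> C') C \<and> cone_face_of (C \<inter> C') C')"

definition complete_simplicial_fan :: "'a::euclidean_space set \<Rightarrow> 'a set set \<Rightarrow> bool" where
  "complete_simplicial_fan V \<F> \<longleftrightarrow> fan \<F> \<and> (\<forall>C\<in>\<F>. simplicial_cone C) \<and> \<Union>\<F> = V"

end

theory Submission
  imports Defs
begin


text \<open>
  Let a vector be written as a nonnegative combination of (unprojected) g-vectors of pairwise
  compatible arcs, and let \<open>a\<close>, \<open>b\<close>, \<open>s\<close>, \<open>t\<close> be the total weights passing above, passing
  below, starting at and ending at the point \<open>k\<close>. The coordinates \<open>2k - 1\<close> and \<open>2k\<close> are
  \<open>(a - b) + (s - t)\<close> and \<open>(a - b) - (s - t)\<close>. Pointedness means that \<open>s\<close> or \<open>t\<close> vanishes, so both are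
  known; since \<open>a + b + t\<close> is the weight arriving from the left, the vector and the weight
  leaving the point \<open>0\<close> determine all of \<open>a\<close>, \<open>b\<close>, \<open>s\<close>, \<open>t\<close>, from left to right. Noncrossing
  means that at each point the highest strands pass above, the next ones end, and the lowest
  ones pass below, so the weights of all arcs are determined as well. Conversely this greedy
  rule produces compatible arcs as soon as the weight leaving \<open>0\<close> is large enough. The two
  external arcs, whose projected g-vectors vanish, account for the freedom in that weight and for
  the projection. Hence every vector of the hyperplane is in a unique way a positive combination
  of the g-vectors of a face, and this gives the fan property.
\<close>

section \<open>Fans from unique decompositions\<close>

definition nonneg_span :: "('i \<Rightarrow> 'a::euclidean_space) \<Rightarrow> 'i set \<Rightarrow> 'a set" where
  "nonneg_span v D = {(\<Sum>\<alpha>\<in>D. c \<alpha> *\<^sub>R v \<alpha>) | c :: 'i \<Rightarrow> real. \<forall>\<alpha>\<in>D. 0 \<le> c \<alpha>}"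

lemma nonneg_spanE:
  assumes "x \<in> nonneg_span v D"
  obtains c where "x = (\<Sum>\<alpha>\<in>D. c \<alpha> *\<^sub>R v \<alpha>)" "\<forall>\<alpha>\<in>D. 0 \<le> c \<alpha>"
  using assms unfolding nonneg_span_def by blast

lemma nonneg_spanI:
  assumes "\<forall>\<alpha>\<in>D. 0 \<le> c \<alpha>"
  shows "(\<Sum>\<alpha>\<in>D. c \<alpha> *\<^sub>R v \<alpha>) \<in> nonneg_span v D"
  using assms unfolding nonneg_span_def by blast

lemma nonneg_span_zero: "0 \<in> nonneg_span v D"
  using nonneg_spanI[of D "\<lambda>_. 0" v] by simp

lemma convex_cone_nonneg_span: "convex_cone (nonneg_span v D)"
proof -
  have "x + y \<in> nonneg_span v D" if xy: "x \<in> nonneg_span v D" "y \<in> nonneg_span v D" for x y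
  proof -
    obtain c where c: "x = (\<Sum>\<alpha>\<in>D. c \<alpha> *\<^sub>R v \<alpha>)" "\<forall>\<alpha>\<in>D. 0 \<le> c \<alpha>"
      using nonneg_spanE[OF xy(1)] by blast
    obtain d where d: "y = (\<Sum>\<alpha>\<in>D. d \<alpha> *\<^sub>R v \<alpha>)" "\<forall>\<alpha>\<in>D. 0 \<le> d \<alpha>"
      using nonneg_spanE[OF xy(2)] by blast
    have "x + y = (\<Sum>\<alpha>\<in>D. (c \<alpha> + d \<alpha>) *\<^sub>R v \<alpha>)"
      by (simp add: c(1) d(1) scaleR_add_left sum.distrib)
    then show ?thesis using nonneg_spanI[of D "\<lambda>\<alpha>. c \<alpha> + d \<alpha>" v] c(2) d(2) by auto
  qed
  moreover have "r *\<^sub>R x \<in> nonneg_span v D" if "x \<in> nonneg_span v D" "0 \<le> r" for x r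
  proof -
    obtain c where c: "x = (\<Sum>\<alpha>\<in>D. c \<alpha> *\<^sub>R v \<alpha>)" "\<forall>\<alpha>\<in>D. 0 \<le> c \<alpha>"
      using \<open>x \<in> nonneg_span v D\<close> nonneg_spanE by blast
    have "r *\<^sub>R x = (\<Sum>\<alpha>\<in>D. (r * c \<alpha>) *\<^sub>R v \<alpha>)"
      by (simp add: c(1) scaleR_sum_right)
    then show ?thesis using nonneg_spanI[of D "\<lambda>\<alpha>. r * c \<alpha>" v] c(2) that(2) by auto
  qed
  ultimately show ?thesis by (simp add: convex_cone_iff nonneg_span_zero)
qed

lemma nonneg_span_generator:
  assumes "finite D" "\<alpha> \<in> D"
  shows "v \<alpha> \<in> nonneg_span v D"
proof -
  have "(\<Sum>\<beta>\<in>D. (if \<beta> = \<alpha> then 1 else 0) *\<^sub>R v \<beta>) = (\<Sum>\<beta>\<in>D. if \<beta> = \<alpha> then v \<beta> else 0)"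
    by (intro sum.cong) auto
  also have "\<dots> = v \<alpha>"
    using assms by simp
  finally show ?thesis
    using nonneg_spanI[of D "\<lambda>\<beta>. if \<beta> = \<alpha> then 1 else 0" v] by auto
qed

text \<open>Links cones given by indexed coefficients to the \<open>convex_cone hull\<close> in the
  definitions of polyhedral and simplicial cones.\<close>

lemma nonneg_span_eq_hull:
  assumes "finite D"
  shows "nonneg_span v D = convex_cone hull (v ` D)"
proof (rule hull_unique[symmetric])
  show "v ` D \<subseteq> nonneg_span v D"
    using nonneg_span_generator[OF assms] by auto
  show "convex_cone (nonneg_span v D)"
    by (rule convex_cone_nonneg_span)
  fix K assume K: "v ` D \<subseteq> K" "convex_cone K"
  show "nonneg_span v D \<subseteq> K"
  proof
    fix x assume "x \<in> nonneg_span v D"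
    then obtain c where c: "x = (\<Sum>\<alpha>\<in>D. c \<alpha> *\<^sub>R v \<alpha>)" "\<forall>\<alpha>\<in>D. 0 \<le> c \<alpha>"
      using nonneg_spanE by blast
    have "(\<Sum>\<alpha>\<in>D'. c \<alpha> *\<^sub>R v \<alpha>) \<in> K" if "D' \<subseteq> D" for D'
      using finite_subset[OF that assms] that
    proof induction
      case empty
      show ?case using K(2) by (simp add: convex_cone_iff)
    next
      case (insert \<alpha> D')
      then show ?case using K c(2) by (auto simp: convex_cone_iff)
    qed
    then show "x \<in> K" using c(1) by auto
  qed
qed

lemma nonneg_span_restrict:
  assumes "finite D" "D' \<subseteq> D" "\<And>\<alpha>. \<alpha> \<in> D - D' \<Longrightarrow> c \<alpha> = 0" "\<forall>\<alpha>\<in>D'. 0 \<le> c \<alpha>"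
  shows "(\<Sum>\<alpha>\<in>D. c \<alpha> *\<^sub>R v \<alpha>) \<in> nonneg_span v D'"
proof -
  have "(\<Sum>\<alpha>\<in>D. c \<alpha> *\<^sub>R v \<alpha>) = (\<Sum>\<alpha>\<in>D'. c \<alpha> *\<^sub>R v \<alpha>)"
    using assms by (intro sum.mono_neutral_right) auto
  then show ?thesis using nonneg_spanI[of D' c v] assms(4) by simp
qed

lemma nonneg_span_mono:
  assumes "finite D" "D' \<subseteq> D"
  shows "nonneg_span v D' \<subseteq> nonneg_span v D"
proof
  fix x assume "x \<in> nonneg_span v D'"
  then obtain c where c: "x = (\<Sum>\<alpha>\<in>D'. c \<alpha> *\<^sub>R v \<alpha>)" "\<forall>\<alpha>\<in>D'. 0 \<le> c \<alpha>"
    using nonneg_spanE by blast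
  have "x = (\<Sum>\<alpha>\<in>D. (if \<alpha> \<in> D' then c \<alpha> else 0) *\<^sub>R v \<alpha>)"
    unfolding c(1) using assms by (intro sum.mono_neutral_cong_left) auto
  then show "x \<in> nonneg_span v D"
    using nonneg_spanI[of D "\<lambda>\<alpha>. if \<alpha> \<in> D' then c \<alpha> else 0" v] c(2) by auto
qed

text \<open>The functional defining the face has maximum 0 on the cone, hence is nonpositive on
  every generator. If it vanishes on a nonnegative combination, only generators on which it vanishes
  can occur with positive coefficient.\<close>

lemma exposed_face_nonneg_span:
  assumes D: "finite D" and F: "cone_face_of F (nonneg_span v D)"
  obtains D' where "D' \<subseteq> D" "F = nonneg_span v D'"
proof -
  obtain a b where ab: "nonneg_span v D \<subseteq> {x. a \<bullet> x \<le> b}" "F = nonneg_span v D \<inter> {x. a \<bullet> x = b}"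
    and "F \<noteq> {}"
    using F unfolding cone_face_of_def exposed_face_of_def by blast
  have "0 \<le> b"
    using ab(1) nonneg_span_zero[of v D] by auto
  \<comment> \<open>A cone is closed under doubling, so a positive maximum attained on it would be
    exceeded.\<close>
  moreover have "b \<le> 0"
  proof -
    obtain y where y: "y \<in> nonneg_span v D" "a \<bullet> y = b"
      using ab \<open>F \<noteq> {}\<close> by blast
    then have "2 *\<^sub>R y \<in> nonneg_span v D"
      using convex_cone_nonneg_span[of v D] by (simp add: convex_cone_iff)
    then have "a \<bullet> (2 *\<^sub>R y) \<le> b" using ab(1) by blast
    then show ?thesis using y by simp
  qed
  ultimately have b: "b = 0" by simp
  define D' where "D' = {\<alpha>\<in>D. a \<bullet> v \<alpha> = 0}"
  have D': "D' \<subseteq> D" by (auto simp: D'_def)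
  have le: "a \<bullet> v \<alpha> \<le> 0" if "\<alpha> \<in> D" for \<alpha>
    using nonneg_span_generator[OF D that, of v] ab(1) b by auto
  have "F = nonneg_span v D'"
  proof
    show "F \<subseteq> nonneg_span v D'"
    proof
      fix x assume "x \<in> F"
      then have x: "x \<in> nonneg_span v D" "a \<bullet> x = 0" using ab b by auto
      obtain c where c: "x = (\<Sum>\<alpha>\<in>D. c \<alpha> *\<^sub>R v \<alpha>)" "\<forall>\<alpha>\<in>D. 0 \<le> c \<alpha>"
        using nonneg_spanE[OF x(1)] by blast
      have "(\<Sum>\<alpha>\<in>D. - (c \<alpha> * (a \<bullet> v \<alpha>))) = 0"
        using x(2) by (simp add: c(1) inner_sum_right sum_negf)
      moreover have "\<forall>\<alpha>\<in>D. 0 \<le> - (c \<alpha> * (a \<bullet> v \<alpha>))"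
        using c(2) le by (simp add: mult_nonneg_nonpos)
      ultimately have "\<forall>\<alpha>\<in>D. - (c \<alpha> * (a \<bullet> v \<alpha>)) = 0"
        using D by (subst (asm) sum_nonneg_eq_0_iff) auto
      then have "c \<alpha> = 0" if "\<alpha> \<in> D - D'" for \<alpha>
        using that by (auto simp: D'_def)
      then show "x \<in> nonneg_span v D'"
        unfolding c(1) using D D' c(2) by (intro nonneg_span_restrict) auto
    qed
    have "a \<bullet> x = 0" if "x \<in> nonneg_span v D'" for x
    proof -
      obtain c where c: "x = (\<Sum>\<alpha>\<in>D'. c \<alpha> *\<^sub>R v \<alpha>)"
        using \<open>x \<in> nonneg_span v D'\<close> nonneg_spanE by blast
      show ?thesis by (auto simp: c inner_sum_right D'_def)
    qed
    then show "nonneg_span v D' \<subseteq> F"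
      using ab(2) b nonneg_span_mono[OF D D', of v] by auto
  qed
  then show ?thesis using that D' by blast
qed

text \<open>Independence provides a functional that is 0 on the generators indexed by
  \<open>D'\<close> and -1 on the others; its maximum over the cone is attained exactly on the
  smaller cone. Injectivity makes the prescribed values unambiguous.\<close>

lemma nonneg_span_cone_face:
  fixes v :: "'i \<Rightarrow> 'a::euclidean_space"
  assumes D: "finite D" "D' \<subseteq> D" and inj: "inj_on v D" and ind: "independent (v ` D)"
  shows "cone_face_of (nonneg_span v D') (nonneg_span v D)"
proof -
  obtain f :: "'a \<Rightarrow> real" where f: "linear f" "\<forall>x\<in>v ` D. f x = (if x \<in> v ` D' then 0 else -1)"
    using linear_independent_extend[OF ind, of "\<lambda>x. if x \<in> v ` D' then 0 else -1"] by blast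
  \<comment> \<open>\<open>adjoint f 1\<close> is the vector representing the functional
    \<open>f\<close> through the inner product.\<close>
  define a where "a = adjoint f 1"
  have a: "a \<bullet> x = f x" for x
    using adjoint_works[OF f(1), of x 1] by (simp add: a_def inner_commute)
  have av: "a \<bullet> v \<alpha> = (if \<alpha> \<in> D' then 0 else -1)" if "\<alpha> \<in> D" for \<alpha>
    using that f(2) inj D(2) by (auto simp: a inj_on_image_mem_iff)
  have ax: "a \<bullet> (\<Sum>\<alpha>\<in>D. c \<alpha> *\<^sub>R v \<alpha>) = - (\<Sum>\<alpha>\<in>D - D'. c \<alpha>)" for c
  proof -
    have "a \<bullet> (\<Sum>\<alpha>\<in>D. c \<alpha> *\<^sub>R v \<alpha>) = (\<Sum>\<alpha>\<in>D. if \<alpha> \<in> D - D' then - c \<alpha> else 0)"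
      unfolding inner_sum_right by (intro sum.cong) (auto simp: av)
    also have "\<dots> = (\<Sum>\<alpha>\<in>D - D'. - c \<alpha>)"
      using D by (intro sum.mono_neutral_cong_right) auto
    finally show ?thesis by (simp add: sum_negf)
  qed
  have "nonneg_span v D \<inter> {x. a \<bullet> x = 0} exposed_face_of nonneg_span v D"
  proof (rule exposed_face_of_Int_supporting_hyperplane_le)
    show "convex (nonneg_span v D)"
      using convex_cone_nonneg_span[of v D] by (simp add: convex_cone_def)
    fix x assume "x \<in> nonneg_span v D"
    then obtain c where "x = (\<Sum>\<alpha>\<in>D. c \<alpha> *\<^sub>R v \<alpha>)" "\<forall>\<alpha>\<in>D. 0 \<le> c \<alpha>"
      using nonneg_spanE by blast
    then show "a \<bullet> x \<le> 0" by (auto simp: ax intro!: sum_nonneg)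
  qed
  moreover have "nonneg_span v D \<inter> {x. a \<bullet> x = 0} = nonneg_span v D'"
  proof
    show "nonneg_span v D \<inter> {x. a \<bullet> x = 0} \<subseteq> nonneg_span v D'"
    proof
      fix x assume x: "x \<in> nonneg_span v D \<inter> {x. a \<bullet> x = 0}"
      then obtain c where c: "x = (\<Sum>\<alpha>\<in>D. c \<alpha> *\<^sub>R v \<alpha>)" "\<forall>\<alpha>\<in>D. 0 \<le> c \<alpha>"
        using nonneg_spanE by blast
      have "(\<Sum>\<alpha>\<in>D - D'. c \<alpha>) = 0" using x c(1) by (simp add: ax)
      then have "\<forall>\<alpha>\<in>D - D'. c \<alpha> = 0"
        using D c(2) by (subst (asm) sum_nonneg_eq_0_iff) auto
      then show "x \<in> nonneg_span v D'"
        unfolding c(1) using D c(2) by (intro nonneg_span_restrict) auto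
    qed
    have "a \<bullet> x = 0" if "x \<in> nonneg_span v D'" for x
    proof -
      obtain c where c: "x = (\<Sum>\<alpha>\<in>D'. c \<alpha> *\<^sub>R v \<alpha>)"
        using \<open>x \<in> nonneg_span v D'\<close> nonneg_spanE by blast
      show ?thesis using D(2) av by (auto simp: c inner_sum_right intro!: sum.neutral)
    qed
    then show "nonneg_span v D' \<subseteq> nonneg_span v D \<inter> {x. a \<bullet> x = 0}"
      using nonneg_span_mono[OF D, of v] by auto
  qed
  ultimately show ?thesis
    using nonneg_span_zero[of v D'] by (auto simp: cone_face_of_def)
qed

section \<open>The fan of a complex with unique nonnegative decompositions\<close>

locale unique_decomposition =
  fixes I :: "'i set" and v :: "'i \<Rightarrow> 'a::euclidean_space" and \<Delta> :: "'i set set"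
  assumes finite_I: "finite I"
    and faces_subset: "\<And>D. D \<in> \<Delta> \<Longrightarrow> D \<subseteq> I"
    and faces_down: "\<And>D D'. D \<in> \<Delta> \<Longrightarrow> D' \<subseteq> D \<Longrightarrow> D' \<in> \<Delta>"
    and decomposition_unique:
      "\<And>c d \<alpha>. \<forall>\<alpha>\<in>I. 0 \<le> c \<alpha> \<Longrightarrow> \<forall>\<alpha>\<in>I. 0 \<le> d \<alpha> \<Longrightarrow>
         {\<alpha>\<in>I. 0 < c \<alpha>} \<in> \<Delta> \<Longrightarrow> {\<alpha>\<in>I. 0 < d \<alpha>} \<in> \<Delta> \<Longrightarrow>
         (\<Sum>\<alpha>\<in>I. c \<alpha> *\<^sub>R v \<alpha>) = (\<Sum>\<alpha>\<in>I. d \<alpha> *\<^sub>R v \<alpha>) \<Longrightarrow> \<alpha> \<in> I \<Longrightarrow> c \<alpha> = d \<alpha>"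
begin

lemma finite_face: "D \<in> \<Delta> \<Longrightarrow> finite D"
  using faces_subset finite_I finite_subset by blast

text \<open>Coefficients on two possibly different faces become comparable after extension by 0 to
  all of \<open>I\<close>; their supports are faces by downward closure.\<close>

lemma unique_on_faces:
  assumes D: "D \<in> \<Delta>" and D': "D' \<in> \<Delta>"
    and c: "\<forall>\<alpha>\<in>D. 0 \<le> c \<alpha>" and d: "\<forall>\<alpha>\<in>D'. 0 \<le> d \<alpha>"
    and eq: "(\<Sum>\<alpha>\<in>D. c \<alpha> *\<^sub>R v \<alpha>) = (\<Sum>\<alpha>\<in>D'. d \<alpha> *\<^sub>R v \<alpha>)"
  shows "(if \<alpha> \<in> D then c \<alpha> else 0) = (if \<alpha> \<in> D' then d \<alpha> else 0)"
proof (cases "\<alpha> \<in> I")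
  case True
  let ?c = "\<lambda>\<alpha>. if \<alpha> \<in> D then c \<alpha> else 0" and ?d = "\<lambda>\<alpha>. if \<alpha> \<in> D' then d \<alpha> else 0"
  have "(\<Sum>\<alpha>\<in>I. ?c \<alpha> *\<^sub>R v \<alpha>) = (\<Sum>\<alpha>\<in>D. c \<alpha> *\<^sub>R v \<alpha>)"
    using finite_I faces_subset[OF D] by (intro sum.mono_neutral_cong_right) auto
  moreover have "(\<Sum>\<alpha>\<in>I. ?d \<alpha> *\<^sub>R v \<alpha>) = (\<Sum>\<alpha>\<in>D'. d \<alpha> *\<^sub>R v \<alpha>)"
    using finite_I faces_subset[OF D'] by (intro sum.mono_neutral_cong_right) auto
  moreover have "{\<alpha>\<in>I. 0 < ?c \<alpha>} \<in> \<Delta>" "{\<alpha>\<in>I. 0 < ?d \<alpha>} \<in> \<Delta>"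
    by (rule faces_down[OF D], auto, rule faces_down[OF D'], auto)
  ultimately show ?thesis
    using decomposition_unique[of ?c ?d \<alpha>] c d eq True by simp
next
  case False
  then show ?thesis using faces_subset[OF D] faces_subset[OF D'] by auto
qed

text \<open>The positive and negative parts of \<open>u\<close> give two nonnegative decompositions
  of one vector over the same face, so they coincide, which happens only for
  \<open>u \<alpha> = 0\<close>.\<close>

lemma no_relation:
  assumes D: "D \<in> \<Delta>" and eq: "(\<Sum>\<alpha>\<in>D. u \<alpha> *\<^sub>R v \<alpha>) = 0" and "\<alpha> \<in> D"
  shows "u \<alpha> = 0"
proof -
  have "(\<Sum>\<alpha>\<in>D. max (u \<alpha>) 0 *\<^sub>R v \<alpha>) - (\<Sum>\<alpha>\<in>D. max (- u \<alpha>) 0 *\<^sub>R v \<alpha>)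
      = (\<Sum>\<alpha>\<in>D. (max (u \<alpha>) 0 - max (- u \<alpha>) 0) *\<^sub>R v \<alpha>)"
    by (simp add: sum_subtractf scaleR_diff_left)
  also have "\<dots> = (\<Sum>\<alpha>\<in>D. u \<alpha> *\<^sub>R v \<alpha>)"
    by (intro sum.cong arg_cong2[where f = scaleR]) auto
  finally have "(\<Sum>\<alpha>\<in>D. max (u \<alpha>) 0 *\<^sub>R v \<alpha>) = (\<Sum>\<alpha>\<in>D. max (- u \<alpha>) 0 *\<^sub>R v \<alpha>)"
    using eq by simp
  from unique_on_faces[OF D D _ _ this, where \<alpha> = \<alpha>] have "max (u \<alpha>) 0 = max (- u \<alpha>) 0"
    using \<open>\<alpha> \<in> D\<close> by simp
  then show ?thesis by linarith
qed

text \<open>Independence of the image set does not detect two indices with the same vector; such a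
  coincidence would be a relation with coefficients 1 and -1.\<close>

lemma inj_on_face:
  assumes D: "D \<in> \<Delta>"
  shows "inj_on v D"
proof (rule inj_onI, rule ccontr)
  fix \<alpha> \<beta> assume ab: "\<alpha> \<in> D" "\<beta> \<in> D" "v \<alpha> = v \<beta>" "\<alpha> \<noteq> \<beta>"
  let ?u = "\<lambda>\<gamma>. if \<gamma> = \<alpha> then 1 else if \<gamma> = \<beta> then -1 else (0::real)"
  have "(\<Sum>\<gamma>\<in>D. ?u \<gamma> *\<^sub>R v \<gamma>) = (\<Sum>\<gamma>\<in>{\<alpha>,\<beta>}. ?u \<gamma> *\<^sub>R v \<gamma>)"
    using finite_face[OF D] ab by (intro sum.mono_neutral_right) auto
  also have "\<dots> = 0" using ab by simp
  finally show False using no_relation[OF D, of ?u \<alpha>] ab(1) by simp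
qed

lemma independent_face:
  assumes D: "D \<in> \<Delta>"
  shows "independent (v ` D)"
  unfolding independent_explicit
proof (intro conjI allI impI ballI)
  show "finite (v ` D)" using finite_face[OF D] by simp
  fix u x assume u: "(\<Sum>x\<in>v ` D. u x *\<^sub>R x) = 0" and "x \<in> v ` D"
  then obtain \<alpha> where \<alpha>: "\<alpha> \<in> D" "x = v \<alpha>" by blast
  have "(\<Sum>\<alpha>\<in>D. u (v \<alpha>) *\<^sub>R v \<alpha>) = 0"
    using u by (simp add: sum.reindex[OF inj_on_face[OF D]])
  then show "u x = 0" using no_relation[OF D, of "u \<circ> v" \<alpha>] \<alpha> by simp
qed

text \<open>A common point has one decomposition over each face; extended by 0 they agree, so no
  index outside \<open>D \<inter> D'\<close> carries weight.\<close>

lemma nonneg_span_Int: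
  assumes D: "D \<in> \<Delta>" and D': "D' \<in> \<Delta>"
  shows "nonneg_span v D \<inter> nonneg_span v D' = nonneg_span v (D \<inter> D')"
proof
  show "nonneg_span v D \<inter> nonneg_span v D' \<subseteq> nonneg_span v (D \<inter> D')"
  proof
    fix x assume x: "x \<in> nonneg_span v D \<inter> nonneg_span v D'"
    obtain c where c: "x = (\<Sum>\<alpha>\<in>D. c \<alpha> *\<^sub>R v \<alpha>)" "\<forall>\<alpha>\<in>D. 0 \<le> c \<alpha>"
      using x nonneg_spanE by blast
    obtain d where d: "x = (\<Sum>\<alpha>\<in>D'. d \<alpha> *\<^sub>R v \<alpha>)" "\<forall>\<alpha>\<in>D'. 0 \<le> d \<alpha>"
      using x nonneg_spanE by blast
    have "c \<alpha> = 0" if "\<alpha> \<in> D - D \<inter> D'" for \<alpha>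
      using unique_on_faces[OF D D' c(2) d(2), where \<alpha> = \<alpha>] c(1) d(1) that by simp
    then show "x \<in> nonneg_span v (D \<inter> D')"
      unfolding c(1) using finite_face[OF D] c(2) by (intro nonneg_span_restrict) auto
  qed
  show "nonneg_span v (D \<inter> D') \<subseteq> nonneg_span v D \<inter> nonneg_span v D'"
    by (intro Int_greatest nonneg_span_mono finite_face D D' Int_lower1 Int_lower2)
qed

lemma complete_simplicial_fanI:
  assumes V: "subspace V" "v ` I \<subseteq> V"
    and ex: "\<And>x. x \<in> V \<Longrightarrow> \<exists>c. (\<forall>\<alpha>\<in>I. 0 \<le> c \<alpha>) \<and> {\<alpha>\<in>I. 0 < c \<alpha>} \<in> \<Delta> \<and> x = (\<Sum>\<alpha>\<in>I. c \<alpha> *\<^sub>R v \<alpha>)"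
  shows "complete_simplicial_fan V (nonneg_span v ` \<Delta>)"
proof -
  have "finite (nonneg_span v ` \<Delta>)"
    using faces_subset finite_I by (intro finite_imageI finite_subset[of \<Delta> "Pow I"]) auto
  moreover have simpl: "\<forall>C\<in>nonneg_span v ` \<Delta>. simplicial_cone C"
  proof
    fix C assume "C \<in> nonneg_span v ` \<Delta>"
    then obtain D where D: "D \<in> \<Delta>" "C = nonneg_span v D" by blast
    show "simplicial_cone C"
      unfolding simplicial_cone_def D(2)
      by (intro exI[of _ "v ` D"] conjI finite_imageI finite_face independent_face nonneg_span_eq_hull D(1))
  qed
  moreover have "\<forall>C\<in>nonneg_span v ` \<Delta>. polyhedral_cone C"
    using simpl unfolding simplicial_cone_def polyhedral_cone_def by meson
  moreover have "\<forall>C\<in>nonneg_span v ` \<Delta>. \<forall>F. cone_face_of F C \<longrightarrow> F \<in> nonneg_span v ` \<Delta>"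
  proof (intro ballI allI impI)
    fix C F assume C: "C \<in> nonneg_span v ` \<Delta>" and F: "cone_face_of F C"
    obtain D where D: "D \<in> \<Delta>" "C = nonneg_span v D" using C by blast
    obtain D' where "D' \<subseteq> D" "F = nonneg_span v D'"
      using exposed_face_nonneg_span[OF finite_face[OF D(1)]] F unfolding D(2) by metis
    then show "F \<in> nonneg_span v ` \<Delta>" using faces_down[OF D(1)] by simp
  qed
  moreover have "\<forall>C\<in>nonneg_span v ` \<Delta>. \<forall>C'\<in>nonneg_span v ` \<Delta>.
      cone_face_of (C \<inter> C') C \<and> cone_face_of (C \<inter> C') C'"
  proof (intro ballI)
    fix C C' assume "C \<in> nonneg_span v ` \<Delta>" "C' \<in> nonneg_span v ` \<Delta>"
    then obtain D D' where D: "D \<in> \<Delta>" "D' \<in> \<Delta>" "C = nonneg_span v D" "C' = nonneg_span v D'"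
      by blast
    show "cone_face_of (C \<inter> C') C \<and> cone_face_of (C \<inter> C') C'"
      unfolding D(3,4) nonneg_span_Int[OF D(1,2)]
      by (intro conjI nonneg_span_cone_face finite_face inj_on_face independent_face D(1,2) Int_lower1 Int_lower2)
  qed
  moreover have "\<Union> (nonneg_span v ` \<Delta>) = V"
  proof (intro equalityI subsetI)
    fix x assume "x \<in> \<Union> (nonneg_span v ` \<Delta>)"
    then obtain D where D: "D \<in> \<Delta>" "x \<in> nonneg_span v D" by blast
    obtain c where c: "x = (\<Sum>\<alpha>\<in>D. c \<alpha> *\<^sub>R v \<alpha>)"
      using nonneg_spanE[OF D(2)] by blast
    show "x \<in> V"
      unfolding c using V faces_subset[OF D(1)] by (intro subspace_sum subspace_scale) auto
  next
    fix x assume "x \<in> V"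
    then obtain c where c: "\<forall>\<alpha>\<in>I. 0 \<le> c \<alpha>" "{\<alpha>\<in>I. 0 < c \<alpha>} \<in> \<Delta>" "x = (\<Sum>\<alpha>\<in>I. c \<alpha> *\<^sub>R v \<alpha>)"
      using ex by blast
    have "x \<in> nonneg_span v {\<alpha>\<in>I. 0 < c \<alpha>}"
      unfolding c(3) using c(1) finite_I by (intro nonneg_span_restrict) (auto simp: order.order_iff_strict)
    then show "x \<in> \<Union> (nonneg_span v ` \<Delta>)" using c(2) by blast
  qed
  ultimately show ?thesis
    unfolding complete_simplicial_fan_def fan_def by (intro conjI)
qed

end



section \<open>Greedy allocations\<close>

text \<open>Elements with larger keys are served first, each up to its capacity \<open>W p\<close>, until the
  amount \<open>a\<close> is used up.\<close>

definition fill :: "'b set \<Rightarrow> ('b \<Rightarrow> real) \<Rightarrow> ('b \<Rightarrow> real) \<Rightarrow> real \<Rightarrow> 'b \<Rightarrow> real" where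
  "fill S key W a p = min (W p) (max 0 (a - (\<Sum>q | q \<in> S \<and> key p < key q. W q)))"

lemma fill_bounds: "0 \<le> W p \<Longrightarrow> 0 \<le> fill S key W a p" "fill S key W a p \<le> W p"
  by (auto simp: fill_def)

lemma fill_mono: "a \<le> b \<Longrightarrow> fill S key W a p \<le> fill S key W b p"
  by (auto simp: fill_def)

text \<open>Some of the amount reaches \<open>q\<close>, so it exceeds the total capacity of
  everything ranked above \<open>q\<close>. That total includes \<open>p\<close> together with
  everything above \<open>p\<close>, hence \<open>p\<close> is saturated.\<close>

lemma fill_greedy:
  assumes S: "finite S" and W: "\<And>q. q \<in> S \<Longrightarrow> 0 \<le> W q"
    and p: "p \<in> S" and pq: "key q < key p" and pos: "0 < fill S key W a q"
  shows "fill S key W a p = W p"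
proof -
  have "(\<Sum>r\<in>insert p {r. r \<in> S \<and> key p < key r}. W r) \<le> (\<Sum>r | r \<in> S \<and> key q < key r. W r)"
    using S W p pq by (intro sum_mono2) auto
  moreover have "(\<Sum>r | r \<in> S \<and> key q < key r. W r) < a"
    using pos by (auto simp: fill_def split: if_splits)
  ultimately show ?thesis using S by (auto simp: fill_def)
qed

text \<open>Negating the key makes \<open>finite_ranking_induct\<close> insert the elements from the
  highest key down. The new element is then served last: it takes what is left and does not change
  the earlier shares.\<close>

lemma sum_fill:
  assumes "finite S" and "inj_on key S" and "\<And>q. q \<in> S \<Longrightarrow> 0 \<le> W q"
    and "0 \<le> a"
  shows "sum (fill S key W a) S = min a (sum W S)"
  using assms(1-3)
proof (induction S rule: finite_ranking_induct[where f = "\<lambda>p. - key p"])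
  case empty
  then show ?case using \<open>0 \<le> a\<close> by simp
next
  case (insert x S)
  show ?case
  proof (cases "x \<in> S")
    case True
    then show ?thesis using insert by (simp add: insert_absorb)
  next
    case False
    have lt: "key x < key y" if "y \<in> S" for y
      using insert.hyps(2)[OF that] insert.prems(1) that False by (fastforce simp: inj_on_def)
    have "fill (insert x S) key W a y = fill S key W a y" if "y \<in> S" for y
    proof -
      have "{q. q \<in> insert x S \<and> key y < key q} = {q. q \<in> S \<and> key y < key q}"
        using lt[OF that] by auto
      then show ?thesis by (simp add: fill_def)
    qed
    then have "sum (fill (insert x S) key W a) S = min a (sum W S)"
      using insert by (simp add: inj_on_def)
    moreover have "{q. q \<in> insert x S \<and> key x < key q} = S"
      using lt by auto
    moreover have "0 \<le> W x" using insert.prems by simp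
    ultimately show ?thesis
      using insert.hyps(1) False by (auto simp: fill_def)
  qed
qed

section \<open>Uniqueness of greedy allocations\<close>

definition greedy :: "'b set \<Rightarrow> ('b \<Rightarrow> real) \<Rightarrow> ('b \<Rightarrow> real) \<Rightarrow> ('b \<Rightarrow> real) \<Rightarrow> bool" where
  "greedy S key W f \<longleftrightarrow> (\<forall>p\<in>S. 0 \<le> f p \<and> f p \<le> W p) \<and>
     (\<forall>p\<in>S. \<forall>q\<in>S. key q < key p \<longrightarrow> 0 < f q \<longrightarrow> f p = W p)"

text \<open>If \<open>f p < g p\<close>, then \<open>f\<close> does not saturate \<open>p\<close>,
  so \<open>f\<close> vanishes below \<open>p\<close>; and \<open>g p\<close> is positive, so
  \<open>g\<close> saturates everything above \<open>p\<close>. Hence \<open>f\<close> is at most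
  \<open>g\<close> everywhere and smaller at \<open>p\<close>, against the equal sums.\<close>

lemma greedy_not_less:
  assumes S: "finite S" and inj: "inj_on key S"
    and f: "greedy S key W f" and g: "greedy S key W g"
    and eq: "sum f S = sum g S" and p: "p \<in> S"
  shows "\<not> f p < g p"
proof
  assume lt: "f p < g p"
  have "f q \<le> g q" if q: "q \<in> S" for q
  proof (cases "key q" "key p" rule: linorder_cases)
    case less
    then have "0 < f q \<Longrightarrow> f p = W p" "g p \<le> W p" "0 \<le> g q" using f g p q by (auto simp: greedy_def)
    then show ?thesis using lt by linarith
  next
    case equal
    then show ?thesis using inj_onD[OF inj] p q lt by force
  next
    case greater
    then have "0 < g p \<Longrightarrow> g q = W q" "f q \<le> W q" "0 \<le> f p" using f g p q by (auto simp: greedy_def)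
    then show ?thesis using lt by linarith
  qed
  then have "sum f S < sum g S" using lt p S by (intro sum_strict_mono_ex1) auto
  then show False using eq by simp
qed

lemma greedy_unique:
  assumes "finite S" "inj_on key S" "greedy S key W f" "greedy S key W g"
    and "sum f S = sum g S" "p \<in> S"
  shows "f p = g p"
  using greedy_not_less[of S key W f g p] greedy_not_less[of S key W g f p] assms by force

section \<open>Strands at a gap\<close>

text \<open>The part of an arc to the left of the gap between \<open>k\<close> and \<open>k + 1\<close> is encoded by the word
  telling, from right to left, whether it passes above (\<^const>\<open>True\<close>) or below the points
  \<open>k, k - 1, \<dots>\<close>; its starting point is \<open>k\<close> minus the length of the word.\<close>

definition words :: "nat \<Rightarrow> bool list set" where
  "words k = {w. length w \<le> k}"

lemma finite_words: "finite (words k)"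
  using finite_lists_length_le[of "UNIV :: bool set" k] by (simp add: words_def)

text \<open>Two strands are compared at the last point where they differ; one starting there lies
  between those passing above and those passing below.\<close>

primrec height :: "bool list \<Rightarrow> real" where
  "height [] = 0"
| "height (x # w) = ((if x then 2 else - 2) + height w) / 3"

text \<open>The height is a ternary expansion with digits 2 and -2. The bound puts words beginning
  with \<open>True\<close> above 1/3, words beginning with \<open>False\<close> below -1/3 and the
  empty word at 0, so the letter of the point nearest the gap decides and ties pass to the
  tails.\<close>

lemma abs_height_less: "\<bar>height w\<bar> < 1"
  by (induction w) auto

lemma height_Cons_less:
  "height (x # p) < height (y # q) \<longleftrightarrow> \<not> x \<and> y \<or> x = y \<and> height p < height q"
  using abs_height_less[of p] abs_height_less[of q] by auto

lemma height_Nil_less: "height [] < height (y # q) \<longleftrightarrow> y" "height (y # q) < height [] \<longleftrightarrow> \<not> y"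
  using abs_height_less[of q] by auto

lemma inj_height: "inj_on height S"
proof (rule inj_onI)
  show "p = q" if "height p = height q" for p q
    using that
  proof (induction p arbitrary: q)
    case Nil
    then show ?case using height_Nil_less by (cases q) (simp_all del: height.simps, metis less_irrefl)
  next
    case (Cons x p)
    then show ?case
    proof (cases q)
      case Nil
      then show ?thesis using Cons.prems height_Nil_less by (metis less_irrefl)
    next
      case (Cons y q')
      then have "x = y" using Cons.prems height_Cons_less by (metis less_irrefl)
      then show ?thesis using Cons Cons.prems Cons.IH by auto
    qed
  qed
qed

section \<open>Arcs, their left parts and the localisation of crossings\<close>

definition src :: "arc \<Rightarrow> nat" where "src \<alpha> = fst \<alpha>"
definition tgt :: "arc \<Rightarrow> nat" where "tgt \<alpha> = fst (snd \<alpha>)"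
definition over_pts :: "arc \<Rightarrow> nat set" where "over_pts \<alpha> = fst (snd (snd \<alpha>))"
definition under_pts :: "arc \<Rightarrow> nat set" where "under_pts \<alpha> = snd (snd (snd \<alpha>))"

lemma arc_components [simp]:
  "src (i, j, A, B) = i" "tgt (i, j, A, B) = j" "over_pts (i, j, A, B) = A" "under_pts (i, j, A, B) = B"
  by (simp_all add: src_def tgt_def over_pts_def under_pts_def)

lemma arc_eqI:
  "src \<alpha> = src \<beta> \<Longrightarrow> tgt \<alpha> = tgt \<beta> \<Longrightarrow> over_pts \<alpha> = over_pts \<beta> \<Longrightarrow> under_pts \<alpha> = under_pts \<beta> \<Longrightarrow> \<alpha> = \<beta>"
  by (simp add: src_def tgt_def over_pts_def under_pts_def prod_eq_iff)

lemma wiggly_arc_iff: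
  "\<alpha> \<in> wiggly_arcs n \<longleftrightarrow> src \<alpha> < tgt \<alpha> \<and> tgt \<alpha> \<le> Suc n \<and>
     over_pts \<alpha> \<union> under_pts \<alpha> = {src \<alpha><..<tgt \<alpha>} \<and> over_pts \<alpha> \<inter> under_pts \<alpha> = {}"
  by (cases \<alpha>) (simp add: wiggly_arcs_def)

lemma finite_wiggly_arcs: "finite (wiggly_arcs n)"
proof (rule finite_subset)
  show "wiggly_arcs n \<subseteq> {..Suc n} \<times> {..Suc n} \<times> Pow {..Suc n} \<times> Pow {..Suc n}"
  proof
    fix \<alpha> assume a: "\<alpha> \<in> wiggly_arcs n"
    obtain i j A B where \<alpha>: "\<alpha> = (i, j, A, B)" by (cases \<alpha>)
    have *: "A \<union> B = {i<..<j}" "i < j" "j \<le> Suc n"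
      using a by (simp_all add: \<alpha> wiggly_arcs_def)
    have "A \<union> B \<subseteq> {..Suc n}"
      unfolding *(1) using *(3) by auto
    then show "\<alpha> \<in> {..Suc n} \<times> {..Suc n} \<times> Pow {..Suc n} \<times> Pow {..Suc n}"
      using *(2,3) by (simp add: \<alpha>)
  qed
qed simp

lemma wiggly_arc_mem:
  assumes "\<alpha> \<in> wiggly_arcs n"
  shows "k \<in> under_pts \<alpha> \<longleftrightarrow> src \<alpha> < k \<and> k < tgt \<alpha> \<and> k \<notin> over_pts \<alpha>"
    and "k \<in> over_pts \<alpha> \<Longrightarrow> src \<alpha> < k \<and> k < tgt \<alpha>"
  using assms unfolding wiggly_arc_iff set_eq_iff Un_iff Int_iff greaterThanLessThan_iff by blast+

text \<open>One half of \<open>crossing\<close>, localised at a point. Keeping the point makes it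
  possible to order the witnesses of the two halves from left to right.\<close>

definition strictly_over :: "arc \<Rightarrow> arc \<Rightarrow> nat \<Rightarrow> bool" where
  "strictly_over \<alpha> \<beta> k \<longleftrightarrow>
     k \<in> over_pts \<alpha> \<and> k \<in> under_pts \<beta> \<or> k \<in> {src \<alpha>, tgt \<alpha>} \<and> k \<in> under_pts \<beta> \<or> k \<in> over_pts \<alpha> \<and> k \<in> {src \<beta>, tgt \<beta>}"

lemma crossing_iff: "crossing \<alpha> \<beta> \<longleftrightarrow> (\<exists>k. strictly_over \<alpha> \<beta> k) \<and> (\<exists>k. strictly_over \<beta> \<alpha> k)"
  by (cases \<alpha>; cases \<beta>) (auto simp: strictly_over_def)

lemma compatible_iff:
  "compatible \<alpha> \<beta> \<longleftrightarrow> src \<alpha> \<noteq> tgt \<beta> \<and> src \<beta> \<noteq> tgt \<alpha> \<and>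
     \<not> ((\<exists>k. strictly_over \<alpha> \<beta> k) \<and> (\<exists>k. strictly_over \<beta> \<alpha> k))"
  unfolding compatible_def crossing_iff by (cases \<alpha>; cases \<beta>) auto

text \<open>The word stands for the left part of a wiggly arc only if
  \<open>src \<alpha> \<le> k\<close> and \<open>k < tgt \<alpha>\<close>: it is empty up to the
  source, and from the target on it merely acquires letters \<open>False\<close>.\<close>

primrec prefix_word :: "arc \<Rightarrow> nat \<Rightarrow> bool list" where
  "prefix_word \<alpha> 0 = []"
| "prefix_word \<alpha> (Suc k) = (if src \<alpha> \<le> k then (Suc k \<in> over_pts \<alpha>) # prefix_word \<alpha> k else [])"

lemma length_prefix_word: "length (prefix_word \<alpha> k) = k - src \<alpha>"
  by (induction k) auto

lemma prefix_word_in_words: "prefix_word \<alpha> k \<in> words k"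
  by (simp add: words_def length_prefix_word)

lemma prefix_word_eq_Nil: "prefix_word \<alpha> k = [] \<longleftrightarrow> k \<le> src \<alpha>"
  using length_prefix_word[of \<alpha> k] by auto

lemma strictly_overD:
  assumes "\<alpha> \<in> wiggly_arcs n" "\<beta> \<in> wiggly_arcs n" "strictly_over \<alpha> \<beta> k"
  shows "src \<alpha> \<le> k" "k \<le> tgt \<alpha>" "src \<beta> \<le> k" "k \<le> tgt \<beta>" "0 < k"
    "k = src \<alpha> \<or> k = tgt \<alpha> \<or> k \<in> over_pts \<alpha>" "k = src \<beta> \<or> k = tgt \<beta> \<or> k \<in> under_pts \<beta>"
    "k \<in> over_pts \<alpha> \<or> k \<in> under_pts \<beta>"
  using assms(1,2)[unfolded wiggly_arc_iff] assms(3)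
    wiggly_arc_mem[OF assms(1), of k] wiggly_arc_mem[OF assms(2), of k]
  by (auto simp: strictly_over_def)

lemma strictly_overI:
  assumes "\<alpha> \<in> wiggly_arcs n" "\<beta> \<in> wiggly_arcs n"
    and "src \<alpha> \<le> k" "k \<le> tgt \<alpha>" "src \<beta> \<le> k" "k \<le> tgt \<beta>"
    and "k = src \<alpha> \<or> k = tgt \<alpha> \<or> k \<in> over_pts \<alpha>" "k = src \<beta> \<or> k = tgt \<beta> \<or> k \<notin> over_pts \<beta>"
    and "k \<in> over_pts \<alpha> \<or> src \<beta> < k \<and> k < tgt \<beta> \<and> k \<notin> over_pts \<beta>"
  shows "strictly_over \<alpha> \<beta> k"
  using assms(3-) wiggly_arc_mem(1)[OF assms(2), of k]
  unfolding strictly_over_def by auto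

text \<open>Moving left from the gap, the two arcs agree until a point where exactly one of them
  starts or where they pass on different sides; this point is the witness. The induction strips the
  common letters.\<close>

lemma strictly_over_of_height:
  assumes ab: "\<alpha> \<in> wiggly_arcs n" "\<beta> \<in> wiggly_arcs n"
    and "src \<alpha> \<le> k" "k < tgt \<alpha>" "src \<beta> \<le> k" "k < tgt \<beta>"
    and "height (prefix_word \<beta> k) < height (prefix_word \<alpha> k)"
  shows "\<exists>m. strictly_over \<alpha> \<beta> m"
  using assms(3-)
proof (induction k)
  case 0
  then show ?case by simp
next
  case (Suc k)
  consider "src \<alpha> = Suc k" "src \<beta> = Suc k" | "src \<alpha> = Suc k" "src \<beta> \<le> k"
    | "src \<alpha> \<le> k" "src \<beta> = Suc k" | "src \<alpha> \<le> k" "src \<beta> \<le> k"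
    using Suc.prems by linarith
  then show ?case
  proof cases
    case 1
    then show ?thesis using Suc.prems(5) by simp
  next
    case 2
    then have "Suc k \<notin> over_pts \<beta>"
      using Suc.prems(5) height_Nil_less by (simp del: height.simps)
    then show ?thesis
      using strictly_overI[OF ab, of "Suc k"] 2 Suc.prems by auto
  next
    case 3
    then have "Suc k \<in> over_pts \<alpha>"
      using Suc.prems(5) height_Nil_less by (simp del: height.simps)
    then show ?thesis
      using strictly_overI[OF ab, of "Suc k"] 3 Suc.prems by auto
  next
    case 4
    then have "Suc k \<notin> over_pts \<beta> \<and> Suc k \<in> over_pts \<alpha> \<or> height (prefix_word \<beta> k) < height (prefix_word \<alpha> k)"
      using Suc.prems(5) by (simp only: prefix_word.simps if_True height_Cons_less) auto
    then show ?thesis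
    proof
      assume "Suc k \<notin> over_pts \<beta> \<and> Suc k \<in> over_pts \<alpha>"
      then show ?thesis
        using strictly_overI[OF ab, of "Suc k"] 4 Suc.prems by auto
    qed (use Suc 4 in auto)
  qed
qed

text \<open>Just after the witness \<open>m\<close> the arc \<alpha> is the higher one. The order
  can be reversed only at a point where \<beta> passes above and \<alpha> below, which would be an
  opposite witness.\<close>

lemma height_of_strictly_over:
  assumes ab: "\<alpha> \<in> wiggly_arcs n" "\<beta> \<in> wiggly_arcs n"
    and m: "strictly_over \<alpha> \<beta> m" and "m \<le> k" and k: "k < tgt \<alpha>" "k < tgt \<beta>"
    and no: "\<And>l. m < l \<Longrightarrow> l \<le> k \<Longrightarrow> \<not> strictly_over \<beta> \<alpha> l"
  shows "height (prefix_word \<beta> k) < height (prefix_word \<alpha> k)"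
  using \<open>m \<le> k\<close> k no
proof (induction k rule: dec_induct)
  case base
  note mD = strictly_overD[OF ab m]
  obtain l where l: "m = Suc l" using mD(5) by (cases m) auto
  have "prefix_word \<alpha> m = [] \<or> (\<exists>p. prefix_word \<alpha> m = True # p)"
    using mD(1,6) base(1) unfolding l by (cases "src \<alpha> = Suc l") auto
  moreover have "prefix_word \<beta> m = [] \<or> (\<exists>q. prefix_word \<beta> m = False # q)"
    using mD(3,7) base(2) wiggly_arc_mem(1)[OF ab(2), of m] unfolding l
    by (cases "src \<beta> = Suc l") auto
  moreover have "\<not> (prefix_word \<alpha> m = [] \<and> prefix_word \<beta> m = [])"
    using mD(8) wiggly_arc_mem[OF ab(1), of m] wiggly_arc_mem[OF ab(2), of m]
    unfolding prefix_word_eq_Nil by linarith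
  ultimately show ?case
    using height_Nil_less height_Cons_less by metis
next
  case (step k)
  note mD = strictly_overD[OF ab m]
  have s: "src \<alpha> \<le> k" "src \<beta> \<le> k"
    using mD step by simp_all
  have "height (prefix_word \<beta> k) < height (prefix_word \<alpha> k)"
    using step by simp
  moreover have "\<not> strictly_over \<beta> \<alpha> (Suc k)" using step by simp
  then have "Suc k \<in> over_pts \<beta> \<Longrightarrow> Suc k \<in> over_pts \<alpha>"
    using strictly_overI[OF ab(2,1), of "Suc k"] s step.prems by auto
  ultimately show ?case using s by (auto simp: height_Cons_less simp del: height.simps)
qed

text \<open>Takes the first opposite witness after \<open>m\<close>. Up to the gap just before it
  the order fixed at \<open>m\<close> persists, so a crossing shows up as a conflict between the
  height order at one gap and the behaviour at the very next point.\<close>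

lemma crossing_height:
  assumes ab: "\<alpha> \<in> wiggly_arcs n" "\<beta> \<in> wiggly_arcs n"
    and m: "strictly_over \<alpha> \<beta> m" and m': "strictly_over \<beta> \<alpha> m'" and "m < m'"
  obtains k where "src \<alpha> \<le> k" "k < tgt \<alpha>" "src \<beta> \<le> k" "k < tgt \<beta>"
    "height (prefix_word \<beta> k) < height (prefix_word \<alpha> k)" "strictly_over \<beta> \<alpha> (Suc k)"
proof -
  define l where "l = (LEAST l. m < l \<and> strictly_over \<beta> \<alpha> l)"
  have l: "m < l" "strictly_over \<beta> \<alpha> l"
    using LeastI[of "\<lambda>l. m < l \<and> strictly_over \<beta> \<alpha> l" m'] assms by (auto simp: l_def)
  have no: "\<not> strictly_over \<beta> \<alpha> l'" if "m < l'" "l' < l" for l'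
    using not_less_Least[of l' "\<lambda>l. m < l \<and> strictly_over \<beta> \<alpha> l"] that by (auto simp: l_def)
  obtain k where k: "l = Suc k" using l(1) by (cases l) auto
  note strictly_overD(1-4)[OF ab m] strictly_overD(1-4)[OF ab(2,1) l(2)]
  then show ?thesis
    using that[of k] k l height_of_strictly_over[OF ab m, of k] no by (simp add: less_Suc_eq_le)
qed



section \<open>Weighted arcs and flows\<close>

definition total_weight :: "nat \<Rightarrow> (arc \<Rightarrow> real) \<Rightarrow> (arc \<Rightarrow> bool) \<Rightarrow> real" where
  "total_weight n c P = (\<Sum>\<alpha> | \<alpha> \<in> wiggly_arcs n \<and> P \<alpha>. c \<alpha>)"

text \<open>\<open>flow n c k w\<close> is the weight crossing the gap between \<open>k\<close> and \<open>k + 1\<close> with left part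
  \<open>w\<close>; \<open>outflow n c k w\<close> is the part of it that ends at the point \<open>k + 1\<close>.\<close>

definition flow :: "nat \<Rightarrow> (arc \<Rightarrow> real) \<Rightarrow> nat \<Rightarrow> bool list \<Rightarrow> real" where
  "flow n c k w = total_weight n c (\<lambda>\<alpha>. src \<alpha> \<le> k \<and> k < tgt \<alpha> \<and> prefix_word \<alpha> k = w)"

definition outflow :: "nat \<Rightarrow> (arc \<Rightarrow> real) \<Rightarrow> nat \<Rightarrow> bool list \<Rightarrow> real" where
  "outflow n c k w = total_weight n c (\<lambda>\<alpha>. tgt \<alpha> = Suc k \<and> prefix_word \<alpha> k = w)"

lemma total_cong:
  assumes "\<And>\<alpha>. \<alpha> \<in> wiggly_arcs n \<Longrightarrow> P \<alpha> \<longleftrightarrow> Q \<alpha>"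
  shows "total_weight n c P = total_weight n c Q"
  unfolding total_weight_def using assms by (intro sum.cong) auto

lemma total_disj:
  assumes "\<And>\<alpha>. \<alpha> \<in> wiggly_arcs n \<Longrightarrow> P \<alpha> \<longleftrightarrow> Q \<alpha> \<or> R \<alpha>" "\<And>\<alpha>. \<alpha> \<in> wiggly_arcs n \<Longrightarrow> \<not> (Q \<alpha> \<and> R \<alpha>)"
  shows "total_weight n c P = total_weight n c Q + total_weight n c R"
proof -
  have "{\<alpha>. \<alpha> \<in> wiggly_arcs n \<and> P \<alpha>} = {\<alpha>. \<alpha> \<in> wiggly_arcs n \<and> Q \<alpha>} \<union> {\<alpha>. \<alpha> \<in> wiggly_arcs n \<and> R \<alpha>}"
    using assms(1) by blast
  moreover have "{\<alpha>. \<alpha> \<in> wiggly_arcs n \<and> Q \<alpha>} \<inter> {\<alpha>. \<alpha> \<in> wiggly_arcs n \<and> R \<alpha>} = {}"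
    using assms(2) by blast
  ultimately show ?thesis
    unfolding total_weight_def using finite_wiggly_arcs by (simp add: sum.union_disjoint)
qed

lemma total_eq_0: "(\<And>\<alpha>. \<alpha> \<in> wiggly_arcs n \<Longrightarrow> \<not> P \<alpha>) \<Longrightarrow> total_weight n c P = 0"
  unfolding total_weight_def by (intro sum.neutral) auto

lemma total_nonneg: "\<forall>\<alpha>\<in>wiggly_arcs n. 0 \<le> c \<alpha> \<Longrightarrow> 0 \<le> total_weight n c P"
  unfolding total_weight_def by (intro sum_nonneg) auto

lemma total_posE:
  assumes "0 < total_weight n c P"
  obtains \<alpha> where "\<alpha> \<in> wiggly_arcs n" "P \<alpha>" "0 < c \<alpha>"
proof -
  have "\<exists>\<alpha>\<in>{\<alpha>. \<alpha> \<in> wiggly_arcs n \<and> P \<alpha>}. 0 < c \<alpha>"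
  proof (rule ccontr)
    assume "\<not> ?thesis"
    then have "total_weight n c P \<le> 0" unfolding total_weight_def by (intro sum_nonpos) force
    then show False using assms by simp
  qed
  then show ?thesis using that by blast
qed

lemma total_ge:
  assumes "\<forall>\<alpha>\<in>wiggly_arcs n. 0 \<le> c \<alpha>" "\<alpha> \<in> wiggly_arcs n" "P \<alpha>"
  shows "c \<alpha> \<le> total_weight n c P"
  unfolding total_weight_def using assms finite_wiggly_arcs by (intro member_le_sum) auto

lemma sum_total_prefix:
  "(\<Sum>p\<in>words l. total_weight n c (\<lambda>\<alpha>. P \<alpha> \<and> prefix_word \<alpha> l = p)) = total_weight n c P"
proof -
  have "total_weight n c (\<lambda>\<alpha>. P \<alpha> \<and> prefix_word \<alpha> l = p) =
      (\<Sum>\<alpha>\<in>{\<alpha>\<in>{\<alpha>. \<alpha> \<in> wiggly_arcs n \<and> P \<alpha>}. prefix_word \<alpha> l = p}. c \<alpha>)" for p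
    unfolding total_weight_def by (intro sum.cong) auto
  then show ?thesis
    using sum.group[of "{\<alpha>. \<alpha> \<in> wiggly_arcs n \<and> P \<alpha>}" "words l" "\<lambda>\<alpha>. prefix_word \<alpha> l" c]
    by (simp add: total_weight_def finite_wiggly_arcs finite_words prefix_word_in_words image_subset_iff)
qed

lemma prefix_word_nth:
  "src \<alpha> < m \<Longrightarrow> m \<le> k \<Longrightarrow> prefix_word \<alpha> k ! (k - m) \<longleftrightarrow> m \<in> over_pts \<alpha>"
  by (induction k) (auto simp: le_Suc_eq Suc_diff_le)

text \<open>Together with \<open>arc_of_word\<close> this makes \<open>words k\<close> a
  parametrisation of the arcs ending at \<open>k + 1\<close>: the length of the word gives the
  source, its letters the side taken at each point.\<close>

lemma prefix_word_inj:
  assumes a: "\<alpha> \<in> wiggly_arcs n" and b: "\<beta> \<in> wiggly_arcs n"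
    and t: "tgt \<alpha> = Suc k" "tgt \<beta> = Suc k" and eq: "prefix_word \<alpha> k = prefix_word \<beta> k"
  shows "\<alpha> = \<beta>"
proof (rule arc_eqI)
  have "k - src \<alpha> = k - src \<beta>"
    using eq length_prefix_word by metis
  moreover have "src \<alpha> \<le> k" "src \<beta> \<le> k"
    using a b t by (simp_all add: wiggly_arc_iff)
  ultimately show s: "src \<alpha> = src \<beta>" by linarith
  show "tgt \<alpha> = tgt \<beta>" using t by simp
  have over_iff: "m \<in> over_pts \<alpha> \<longleftrightarrow> m \<in> over_pts \<beta>" for m
  proof (cases "src \<alpha> < m \<and> m \<le> k")
    case True
    then show ?thesis using prefix_word_nth[of \<alpha> m k] prefix_word_nth[of \<beta> m k] eq s by simp
  next
    case False
    then show ?thesis using wiggly_arc_mem(2)[OF a, of m] wiggly_arc_mem(2)[OF b, of m] s t by auto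
  qed
  then show "over_pts \<alpha> = over_pts \<beta>" by blast
  have "m \<in> under_pts \<alpha> \<longleftrightarrow> m \<in> under_pts \<beta>" for m
    using wiggly_arc_mem(1)[OF a, of m] wiggly_arc_mem(1)[OF b, of m] over_iff s t by simp
  then show "under_pts \<alpha> = under_pts \<beta>" by blast
qed

lemma arc_of_word:
  assumes w: "w \<in> words k" and k: "k \<le> n"
  obtains \<alpha> where "\<alpha> \<in> wiggly_arcs n" "tgt \<alpha> = Suc k" "prefix_word \<alpha> k = w"
proof -
  define i where "i = k - length w"
  define A where "A = {m. i < m \<and> m \<le> k \<and> w ! (k - m)}"
  define \<alpha> where "\<alpha> = (i, Suc k, A, {i<..<Suc k} - A)"
  have len: "length w \<le> k" using w by (simp add: words_def)
  have "A \<subseteq> {i<..<Suc k}" by (auto simp: A_def)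
  then have "\<alpha> \<in> wiggly_arcs n"
    using k by (auto simp: \<alpha>_def wiggly_arc_iff i_def)
  \<comment> \<open>The gap \<open>m\<close> sees only the letters of the points up to
    \<open>m\<close>, which form the tail of \<open>w\<close> after its first \<open>k - m\<close>
    letters.\<close>
  moreover have "prefix_word \<alpha> m = drop (k - m) w" if "m \<le> k" for m
    using that
  proof (induction m)
    case 0
    then show ?case using len by simp
  next
    case (Suc m)
    show ?case
    proof (cases "i \<le> m")
      case True
      then have lt: "k - Suc m < length w" using Suc.prems len by (simp add: i_def)
      have "drop (k - Suc m) w = w ! (k - Suc m) # drop (Suc (k - Suc m)) w"
        using Cons_nth_drop_Suc[OF lt] by simp
      moreover have "Suc (k - Suc m) = k - m" using Suc.prems by simp
      ultimately show ?thesis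
        using Suc True by (simp add: \<alpha>_def A_def)
    next
      case False
      then show ?thesis using Suc.prems by (simp add: \<alpha>_def i_def)
    qed
  qed
  then have "prefix_word \<alpha> k = w" by simp
  moreover have "tgt \<alpha> = Suc k" by (simp add: \<alpha>_def)
  ultimately show ?thesis using that by blast
qed

text \<open>At the gap before its target the left part encodes the whole arc, so a single weight is
  read off from the outflow there.\<close>

lemma outflow_prefix_word:
  assumes a: "\<alpha> \<in> wiggly_arcs n" "tgt \<alpha> = Suc k"
  shows "outflow n c k (prefix_word \<alpha> k) = c \<alpha>"
proof -
  have "{\<beta>. \<beta> \<in> wiggly_arcs n \<and> tgt \<beta> = Suc k \<and> prefix_word \<beta> k = prefix_word \<alpha> k} = {\<alpha>}"
    using a prefix_word_inj by blast
  then show ?thesis by (simp add: outflow_def total_weight_def)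
qed

lemma flow_outside: "w \<notin> words k \<Longrightarrow> flow n c k w = 0"
  unfolding flow_def using prefix_word_in_words by (intro total_eq_0) blast

lemma outflow_outside: "w \<notin> words k \<Longrightarrow> outflow n c k w = 0"
  unfolding outflow_def using prefix_word_in_words by (intro total_eq_0) blast

lemma flow_Cons:
  "flow n c (Suc l) (x # p) =
     total_weight n c (\<lambda>\<alpha>. (if x then Suc l \<in> over_pts \<alpha> else Suc l \<in> under_pts \<alpha>) \<and> prefix_word \<alpha> l = p)"
  unfolding flow_def
proof (rule total_cong)
  fix \<alpha> assume "\<alpha> \<in> wiggly_arcs n"
  from wiggly_arc_mem[OF this, of "Suc l"]
  show "src \<alpha> \<le> Suc l \<and> Suc l < tgt \<alpha> \<and> prefix_word \<alpha> (Suc l) = x # p \<longleftrightarrow>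
      (if x then Suc l \<in> over_pts \<alpha> else Suc l \<in> under_pts \<alpha>) \<and> prefix_word \<alpha> l = p"
    by auto
qed

lemma flow_conservation:
  assumes "l < n"
  shows "flow n c l p = flow n c (Suc l) (True # p) + flow n c (Suc l) (False # p) + outflow n c l p"
proof -
  have "flow n c l p = total_weight n c (\<lambda>\<alpha>. (Suc l \<in> over_pts \<alpha> \<or> Suc l \<in> under_pts \<alpha>) \<and> prefix_word \<alpha> l = p)
      + outflow n c l p"
    unfolding flow_def outflow_def
  proof (rule total_disj)
    fix \<alpha> assume a: "\<alpha> \<in> wiggly_arcs n"
    note mem = wiggly_arc_mem[OF a, of "Suc l"]
    have "src \<alpha> < tgt \<alpha>" using a by (simp add: wiggly_arc_iff)
    then show "(src \<alpha> \<le> l \<and> l < tgt \<alpha> \<and> prefix_word \<alpha> l = p) \<longleftrightarrow>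
        ((Suc l \<in> over_pts \<alpha> \<or> Suc l \<in> under_pts \<alpha>) \<and> prefix_word \<alpha> l = p) \<or>
        (tgt \<alpha> = Suc l \<and> prefix_word \<alpha> l = p)"
      using mem by auto
    show "\<not> (((Suc l \<in> over_pts \<alpha> \<or> Suc l \<in> under_pts \<alpha>) \<and> prefix_word \<alpha> l = p) \<and>
        (tgt \<alpha> = Suc l \<and> prefix_word \<alpha> l = p))"
      using mem by auto
  qed
  also have "total_weight n c (\<lambda>\<alpha>. (Suc l \<in> over_pts \<alpha> \<or> Suc l \<in> under_pts \<alpha>) \<and> prefix_word \<alpha> l = p)
      = flow n c (Suc l) (True # p) + flow n c (Suc l) (False # p)"
    unfolding flow_Cons if_True if_False simp_thms
    using wiggly_arc_mem by (intro total_disj) blast+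
  finally show ?thesis .
qed

lemma flow_last: "flow n c n p = outflow n c n p"
  unfolding flow_def outflow_def by (intro total_cong) (auto simp: wiggly_arc_iff)

lemma flow_Nil: "flow n c k [] = total_weight n c (\<lambda>\<alpha>. src \<alpha> = k)"
  unfolding flow_def prefix_word_eq_Nil by (intro total_cong) (auto simp: wiggly_arc_iff)

lemma sum_flow_True: "(\<Sum>p\<in>words l. flow n c (Suc l) (True # p)) = total_weight n c (\<lambda>\<alpha>. Suc l \<in> over_pts \<alpha>)"
  unfolding flow_Cons if_True by (rule sum_total_prefix)

lemma sum_flow_False: "(\<Sum>p\<in>words l. flow n c (Suc l) (False # p)) = total_weight n c (\<lambda>\<alpha>. Suc l \<in> under_pts \<alpha>)"
  unfolding flow_Cons if_False simp_thms by (rule sum_total_prefix)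

lemma sum_outflow: "(\<Sum>p\<in>words l. outflow n c l p) = total_weight n c (\<lambda>\<alpha>. tgt \<alpha> = Suc l)"
  unfolding outflow_def by (rule sum_total_prefix)

lemma sum_flow:
  assumes "l < n"
  shows "(\<Sum>p\<in>words l. flow n c l p) = total_weight n c (\<lambda>\<alpha>. Suc l \<in> over_pts \<alpha>)
     + total_weight n c (\<lambda>\<alpha>. Suc l \<in> under_pts \<alpha>) + total_weight n c (\<lambda>\<alpha>. tgt \<alpha> = Suc l)"
  unfolding flow_conservation[OF assms] sum.distrib sum_flow_True sum_flow_False sum_outflow ..

section \<open>Laminations\<close>

text \<open>External arcs may carry weight too; they are compatible with every arc, and their
  weights absorb what the projection forgets.\<close>

definition lamination :: "nat \<Rightarrow> (arc \<Rightarrow> real) \<Rightarrow> bool" where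
  "lamination n c \<longleftrightarrow> (\<forall>\<alpha>\<in>wiggly_arcs n. 0 \<le> c \<alpha>) \<and> pairwise compatible {\<alpha>\<in>wiggly_arcs n. 0 < c \<alpha>}"

lemma lamination_compatible:
  assumes "lamination n c" "\<alpha> \<in> wiggly_arcs n" "0 < c \<alpha>" "\<beta> \<in> wiggly_arcs n" "0 < c \<beta>" "\<alpha> \<noteq> \<beta>"
  shows "compatible \<alpha> \<beta>"
  using assms unfolding lamination_def by (metis (mono_tags, lifting) mem_Collect_eq pairwiseD)

text \<open>The height order at a shared gap is global: the higher arc is already strictly over the
  lower one somewhere, so the reverse would complete a crossing.\<close>

lemma lamination_not_strictly_over:
  assumes lam: "lamination n c"
    and a: "\<alpha> \<in> wiggly_arcs n" "0 < c \<alpha>" "src \<alpha> \<le> l" "l < tgt \<alpha>"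
    and b: "\<beta> \<in> wiggly_arcs n" "0 < c \<beta>" "src \<beta> \<le> l" "l < tgt \<beta>"
    and less: "height (prefix_word \<beta> l) < height (prefix_word \<alpha> l)"
  shows "\<not> strictly_over \<beta> \<alpha> m"
proof -
  have "\<alpha> \<noteq> \<beta>" using less by auto
  then have "compatible \<alpha> \<beta>"
    using lamination_compatible[OF lam] a b by simp
  moreover have "\<exists>m. strictly_over \<alpha> \<beta> m"
    using strictly_over_of_height[OF a(1) b(1) a(3,4) b(3,4) less] .
  ultimately show ?thesis unfolding compatible_iff by blast
qed

text \<open>An arc starting at \<open>k\<close> and one ending at \<open>k\<close> would be non
  pointed. This is why the difference of the two totals determines both.\<close>

lemma lamination_pointed:
  assumes lam: "lamination n c"
  shows "total_weight n c (\<lambda>\<alpha>. src \<alpha> = k) = 0 \<or> total_weight n c (\<lambda>\<alpha>. tgt \<alpha> = k) = 0"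
proof (rule ccontr)
  have nn: "\<forall>\<alpha>\<in>wiggly_arcs n. 0 \<le> c \<alpha>" using lam by (simp add: lamination_def)
  assume "\<not> ?thesis"
  then have "0 < total_weight n c (\<lambda>\<alpha>. src \<alpha> = k)" "0 < total_weight n c (\<lambda>\<alpha>. tgt \<alpha> = k)"
    using total_nonneg[OF nn, of "\<lambda>\<alpha>. src \<alpha> = k"] total_nonneg[OF nn, of "\<lambda>\<alpha>. tgt \<alpha> = k"] by linarith+
  then obtain \<alpha> \<beta> where a: "\<alpha> \<in> wiggly_arcs n" "src \<alpha> = k" "0 < c \<alpha>"
    and b: "\<beta> \<in> wiggly_arcs n" "tgt \<beta> = k" "0 < c \<beta>"
    by (elim total_posE) blast
  have "\<alpha> \<noteq> \<beta>" using a b by (auto simp: wiggly_arc_iff)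
  then have "compatible \<alpha> \<beta>"
    using lamination_compatible[OF lam] a b by simp
  then show False using a b by (simp add: compatible_iff)
qed

text \<open>By noncrossing, the strands passing above \<open>l + 1\<close> are the topmost and those
  ending there come next. The two allocations are the resulting top segments, without and with the
  ending strands.\<close>

lemma lamination_greedy:
  assumes lam: "lamination n c" and l: "l < n"
  shows "greedy (words l) height (flow n c l) (\<lambda>p. flow n c (Suc l) (True # p))"
    and "greedy (words l) height (flow n c l) (\<lambda>p. flow n c (Suc l) (True # p) + outflow n c l p)"
proof -
  have nn: "\<forall>\<alpha>\<in>wiggly_arcs n. 0 \<le> c \<alpha>" using lam by (simp add: lamination_def)
  have nf: "0 \<le> flow n c k p" "0 \<le> outflow n c k p" for k p
    unfolding flow_def outflow_def by (rule total_nonneg[OF nn])+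
  \<comment> \<open>A lower strand passing above or ending at \<open>l + 1\<close> would be strictly
    over a higher one passing below.\<close>
  have down: "flow n c (Suc l) (False # p) = 0"
    if less: "height q < height p" and pos: "0 < flow n c (Suc l) (True # q) + outflow n c l q" for p q
  proof (rule ccontr)
    assume "\<not> ?thesis"
    then have "0 < flow n c (Suc l) (False # p)" using nf(1)[of "Suc l" "False # p"] by linarith
    then obtain \<alpha> where a: "\<alpha> \<in> wiggly_arcs n" "Suc l \<in> under_pts \<alpha>" "prefix_word \<alpha> l = p" "0 < c \<alpha>"
      unfolding flow_Cons by (auto elim: total_posE)
    have "0 < flow n c (Suc l) (True # q) \<or> 0 < outflow n c l q" using pos by linarith
    then obtain \<beta> where b: "\<beta> \<in> wiggly_arcs n" "Suc l \<in> over_pts \<beta> \<or> tgt \<beta> = Suc l" "prefix_word \<beta> l = q" "0 < c \<beta>"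
      unfolding flow_Cons outflow_def by (auto elim!: total_posE)
    have as: "src \<alpha> \<le> l" "Suc l < tgt \<alpha>" "Suc l \<notin> over_pts \<alpha>"
      using a wiggly_arc_mem[OF a(1)] by auto
    have bs: "src \<beta> \<le> l" "Suc l \<le> tgt \<beta>"
      using b(1,2) wiggly_arc_mem[OF b(1), of "Suc l"] unfolding wiggly_arc_iff by auto
    have "strictly_over \<beta> \<alpha> (Suc l)"
      using strictly_overI[OF b(1) a(1), of "Suc l"] as bs b(2) by auto
    moreover have "\<not> strictly_over \<beta> \<alpha> (Suc l)"
      using lamination_not_strictly_over[OF lam a(1,4) _ _ b(1,4)] as bs a(3) b(3) less by simp
    ultimately show False by simp
  qed
  \<comment> \<open>A lower strand passing above \<open>l + 1\<close> would be strictly over a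
    higher one ending there.\<close>
  have stop: "outflow n c l p = 0"
    if less: "height q < height p" and pos: "0 < flow n c (Suc l) (True # q)" for p q
  proof (rule ccontr)
    assume "\<not> ?thesis"
    then have "0 < outflow n c l p" using nf(2)[of l p] by linarith
    then obtain \<alpha> where a: "\<alpha> \<in> wiggly_arcs n" "tgt \<alpha> = Suc l" "prefix_word \<alpha> l = p" "0 < c \<alpha>"
      unfolding outflow_def by (auto elim: total_posE)
    obtain \<beta> where b: "\<beta> \<in> wiggly_arcs n" "Suc l \<in> over_pts \<beta>" "prefix_word \<beta> l = q" "0 < c \<beta>"
      using pos unfolding flow_Cons by (auto elim: total_posE)
    have as: "src \<alpha> \<le> l"
      using a(1,2) by (simp add: wiggly_arc_iff)
    have bs: "src \<beta> \<le> l" "Suc l < tgt \<beta>"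
      using b(2) wiggly_arc_mem[OF b(1), of "Suc l"] by auto
    have "strictly_over \<beta> \<alpha> (Suc l)"
      using strictly_overI[OF b(1) a(1), of "Suc l"] as bs a(2) b(2) by auto
    moreover have "\<not> strictly_over \<beta> \<alpha> (Suc l)"
      using lamination_not_strictly_over[OF lam a(1,4) _ _ b(1,4)] as bs a(2,3) b(3) less by simp
    ultimately show False by simp
  qed
  show "greedy (words l) height (flow n c l) (\<lambda>p. flow n c (Suc l) (True # p))"
    unfolding greedy_def flow_conservation[OF l, of c]
  proof (intro conjI ballI impI)
    fix p q assume less: "height q < height p" and pos: "0 < flow n c (Suc l) (True # q)"
    have "0 < flow n c (Suc l) (True # q) + outflow n c l q" using pos nf(2)[of l q] by linarith
    then show "flow n c (Suc l) (True # p) =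
        flow n c (Suc l) (True # p) + flow n c (Suc l) (False # p) + outflow n c l p"
      using down[OF less] stop[OF less pos] by simp
  qed (simp_all add: nf add_increasing2 add.assoc)
  show "greedy (words l) height (flow n c l) (\<lambda>p. flow n c (Suc l) (True # p) + outflow n c l p)"
    unfolding greedy_def flow_conservation[OF l, of c]
  proof (intro conjI ballI impI)
    fix p q assume "height q < height p" "0 < flow n c (Suc l) (True # q) + outflow n c l q"
    from down[OF this] show "flow n c (Suc l) (True # p) + outflow n c l p =
        flow n c (Suc l) (True # p) + flow n c (Suc l) (False # p) + outflow n c l p"
      by simp
  qed (simp_all add: nf)
qed

lemma lamination_unique:
  assumes c: "lamination n c" and d: "lamination n d"
    and start: "total_weight n c (\<lambda>\<alpha>. src \<alpha> = 0) = total_weight n d (\<lambda>\<alpha>. src \<alpha> = 0)"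
    and pass: "\<And>k. 1 \<le> k \<Longrightarrow> k \<le> n \<Longrightarrow>
      total_weight n c (\<lambda>\<alpha>. k \<in> over_pts \<alpha>) - total_weight n c (\<lambda>\<alpha>. k \<in> under_pts \<alpha>) =
      total_weight n d (\<lambda>\<alpha>. k \<in> over_pts \<alpha>) - total_weight n d (\<lambda>\<alpha>. k \<in> under_pts \<alpha>)"
    and ends: "\<And>k. 1 \<le> k \<Longrightarrow> k \<le> n \<Longrightarrow>
      total_weight n c (\<lambda>\<alpha>. src \<alpha> = k) - total_weight n c (\<lambda>\<alpha>. tgt \<alpha> = k) =
      total_weight n d (\<lambda>\<alpha>. src \<alpha> = k) - total_weight n d (\<lambda>\<alpha>. tgt \<alpha> = k)"
    and \<alpha>: "\<alpha> \<in> wiggly_arcs n"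
  shows "c \<alpha> = d \<alpha>"
proof -
  have nn: "\<forall>\<alpha>\<in>wiggly_arcs n. 0 \<le> c \<alpha>" "\<forall>\<alpha>\<in>wiggly_arcs n. 0 \<le> d \<alpha>"
    using c d by (simp_all add: lamination_def)
  have step: "outflow n c l p = outflow n d l p \<and> flow n c (Suc l) q = flow n d (Suc l) q"
    if l: "l < n" and eq: "flow n c l = flow n d l" for l p q
  proof -
    let ?t = "\<lambda>c P. total_weight n c P"
    \<comment> \<open>Two pairs of nonnegative numbers, each with a vanishing member, are equal as
      soon as their differences are.\<close>
    have st: "?t c (\<lambda>\<alpha>. src \<alpha> = Suc l) = ?t d (\<lambda>\<alpha>. src \<alpha> = Suc l)"
      "?t c (\<lambda>\<alpha>. tgt \<alpha> = Suc l) = ?t d (\<lambda>\<alpha>. tgt \<alpha> = Suc l)"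
      using ends[of "Suc l"] l lamination_pointed[OF c, of "Suc l"] lamination_pointed[OF d, of "Suc l"]
        total_nonneg[OF nn(1), of "\<lambda>\<alpha>. src \<alpha> = Suc l"] total_nonneg[OF nn(2), of "\<lambda>\<alpha>. src \<alpha> = Suc l"]
        total_nonneg[OF nn(1), of "\<lambda>\<alpha>. tgt \<alpha> = Suc l"] total_nonneg[OF nn(2), of "\<lambda>\<alpha>. tgt \<alpha> = Suc l"]
      by auto
    \<comment> \<open>The weights above and below have a known difference by \<open>pass\<close>,
      and their sum is the flow at gap \<open>l\<close> minus the weight ending at
      \<open>l + 1\<close>.\<close>
    have up: "?t c (\<lambda>\<alpha>. Suc l \<in> over_pts \<alpha>) = ?t d (\<lambda>\<alpha>. Suc l \<in> over_pts \<alpha>)"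
      using sum_flow[OF l, of c] sum_flow[OF l, of d] pass[of "Suc l"] l st eq by simp
    have T: "flow n c (Suc l) (True # p) = flow n d (Suc l) (True # p)" if "p \<in> words l" for p
      using greedy_unique[OF finite_words inj_height lamination_greedy(1)[OF c l]
          lamination_greedy(1)[OF d l, folded eq] _ that] up
      by (simp add: sum_flow_True)
    have O: "flow n c (Suc l) (True # p) + outflow n c l p = flow n d (Suc l) (True # p) + outflow n d l p"
      if "p \<in> words l" for p
      using greedy_unique[OF finite_words inj_height lamination_greedy(2)[OF c l]
          lamination_greedy(2)[OF d l, folded eq] _ that] up st
      by (simp add: sum_flow_True sum_outflow sum.distrib)
    have o: "outflow n c l p = outflow n d l p" for p
      using T[of p] O[of p] outflow_outside[of p l] by (cases "p \<in> words l") auto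
    have F: "flow n c (Suc l) (False # p) = flow n d (Suc l) (False # p)" if "p \<in> words l" for p
      using flow_conservation[OF l, of c p] flow_conservation[OF l, of d p] T[OF that] o[of p] eq by simp
    have "flow n c (Suc l) q = flow n d (Suc l) q"
    proof (cases q)
      case Nil
      then show ?thesis using st by (simp add: flow_Nil)
    next
      case (Cons x p)
      show ?thesis
      proof (cases "p \<in> words l")
        case True
        then show ?thesis using T F Cons by (cases x) simp_all
      next
        case False
        then have "q \<notin> words (Suc l)" using Cons by (simp add: words_def)
        then show ?thesis by (simp add: flow_outside)
      qed
    qed
    then show ?thesis using o by simp
  qed
  have flow_eq: "flow n c k = flow n d k" if "k \<le> n" for k
    using that
  proof (induction k)
    case 0
    show ?case
    proof
      fix w
      show "flow n c 0 w = flow n d 0 w"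
      proof (cases "w = []")
        case True
        then show ?thesis using start by (simp add: flow_Nil)
      next
        case False
        then show ?thesis by (simp add: flow_outside words_def)
      qed
    qed
  next
    case (Suc k)
    then show ?case using step[of k] by auto
  qed
  obtain k where k: "tgt \<alpha> = Suc k" "k \<le> n"
    using \<alpha> by (cases "tgt \<alpha>") (auto simp: wiggly_arc_iff)
  have "outflow n c k (prefix_word \<alpha> k) = outflow n d k (prefix_word \<alpha> k)"
  proof (cases "k < n")
    case True
    then show ?thesis using step flow_eq by simp
  next
    \<comment> \<open>Here \<open>k = n\<close>, and all that crosses the last gap ends at
      \<open>n + 1\<close>.\<close>
    case False
    then show ?thesis using k flow_eq[of n] flow_last by (metis le_neq_implies_less order_refl)
  qed
  then show ?thesis by (simp add: outflow_prefix_word[OF \<alpha> k(1)])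
qed

section \<open>Existence of laminations by the greedy rule\<close>

lemma words_Suc: "words (Suc l) = insert [] ((#) True ` words l \<union> (#) False ` words l)"
proof -
  have "w \<in> words (Suc l) \<longleftrightarrow> w \<in> insert [] ((#) True ` words l \<union> (#) False ` words l)" for w
    by (cases w) (auto simp: words_def image_iff)
  then show ?thesis by blast
qed

lemma sum_words_Suc:
  "(\<Sum>w\<in>words (Suc l). f w) = f [] + (\<Sum>p\<in>words l. f (True # p)) + (\<Sum>p\<in>words l. f (False # p) :: real)"
proof -
  have "(\<Sum>w\<in>words (Suc l). f w) = f [] + (sum f ((#) True ` words l) + sum f ((#) False ` words l))"
    unfolding words_Suc
    by (subst sum.insert; (subst sum.union_disjoint)?) (auto simp: finite_words)
  then show ?thesis by (simp add: sum.reindex)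
qed

text \<open>\<open>s k\<close>, \<open>t k\<close> and \<open>a k\<close> prescribe the weights starting at, ending at and passing above the
  point \<open>k\<close>. The right-hand side of \<open>a_le\<close> is the weight crossing the gap after \<open>l\<close>, of
  which the highest strands pass above \<open>l + 1\<close>, the next ones end there and the rest pass below.\<close>

locale greedy_flow =
  fixes n :: nat and s t a :: "nat \<Rightarrow> real"
  assumes s_nonneg: "0 \<le> s k" and t_nonneg: "0 \<le> t k" and pointed: "s k = 0 \<or> t k = 0"
    and a_nonneg: "l < n \<Longrightarrow> 0 \<le> a (Suc l)"
    and a_le: "l < n \<Longrightarrow> a (Suc l) + t (Suc l) \<le> s 0 + (\<Sum>k = 1..l. s k - t k)"
begin

text \<open>The flow at successive gaps is prescribed before any arc has a weight;
  \<open>flow_weight\<close> shows that the weights defined from it realise it.\<close>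

primrec gflow :: "nat \<Rightarrow> bool list \<Rightarrow> real" where
  "gflow 0 = (\<lambda>w. if w = [] then s 0 else 0)"
| "gflow (Suc l) = (\<lambda>w. case w of [] \<Rightarrow> s (Suc l)
     | x # p \<Rightarrow> if x then fill (words l) height (gflow l) (a (Suc l)) p
         else gflow l p - fill (words l) height (gflow l) (a (Suc l) + t (Suc l)) p)"

text \<open>Strands ending at \<open>l + 1\<close> lie within the top amount
  \<open>a (Suc l) + t (Suc l)\<close> but below the top amount \<open>a (Suc l)\<close>; after the
  last gap everything left ends at \<open>n + 1\<close>.\<close>

definition gout :: "nat \<Rightarrow> bool list \<Rightarrow> real" where
  "gout l p = (if l < n then fill (words l) height (gflow l) (a (Suc l) + t (Suc l)) p
       - fill (words l) height (gflow l) (a (Suc l)) p else gflow l p)"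

definition weight :: "arc \<Rightarrow> real" where
  "weight \<alpha> = gout (tgt \<alpha> - 1) (prefix_word \<alpha> (tgt \<alpha> - 1))"

lemma gflow_nonneg: "0 \<le> gflow k w"
  using s_nonneg by (induction k arbitrary: w) (auto simp: fill_bounds split: list.split)

lemma gflow_outside: "w \<notin> words k \<Longrightarrow> gflow k w = 0"
proof (induction k arbitrary: w)
  case 0
  then show ?case by (auto simp: words_def)
next
  case (Suc k)
  then obtain x p where w: "w = x # p" "p \<notin> words k"
    by (cases w) (auto simp: words_def)
  then show ?case using Suc.IH[OF w(2)] by (simp add: fill_def)
qed

lemma gout_nonneg: "0 \<le> gout k w"
  using gflow_nonneg t_nonneg by (simp add: gout_def fill_mono)

lemma gout_outside: "w \<notin> words k \<Longrightarrow> gout k w = 0"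
  by (simp add: gout_def gflow_outside fill_def)

text \<open>By \<open>a_le\<close> both demands stay within the available flow, so the minimum in
  \<open>sum_fill\<close> is the demand. The total of \<open>gflow l\<close> is a hypothesis because
  this serves in the induction that computes it.\<close>

lemma sum_fill_gflow:
  assumes l: "l < n" and sum: "(\<Sum>w\<in>words l. gflow l w) = s 0 + (\<Sum>k = 1..l. s k - t k)"
  shows "(\<Sum>p\<in>words l. fill (words l) height (gflow l) (a (Suc l)) p) = a (Suc l)"
    and "(\<Sum>p\<in>words l. fill (words l) height (gflow l) (a (Suc l) + t (Suc l)) p) = a (Suc l) + t (Suc l)"
  using sum a_nonneg[OF l] a_le[OF l] t_nonneg[of "Suc l"] gflow_nonneg
  by (subst sum_fill[OF finite_words inj_height]; simp)+

lemma sum_gflow: "k \<le> n \<Longrightarrow> (\<Sum>w\<in>words k. gflow k w) = s 0 + (\<Sum>k = 1..k. s k - t k)"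
proof (induction k)
  case 0
  have "words 0 = {[]}" by (auto simp: words_def)
  then show ?case by simp
next
  case (Suc l)
  then show ?case
    using sum_fill_gflow[of l] by (simp add: sum_words_Suc sum_subtractf)
qed

lemma outflow_weight:
  assumes "k \<le> n"
  shows "outflow n weight k p = gout k p"
proof (cases "p \<in> words k")
  case True
  then obtain \<alpha> where \<alpha>: "\<alpha> \<in> wiggly_arcs n" "tgt \<alpha> = Suc k" "prefix_word \<alpha> k = p"
    using arc_of_word assms by blast
  then show ?thesis using outflow_prefix_word[OF \<alpha>(1,2), of weight] by (simp add: weight_def)
next
  case False
  then show ?thesis by (simp add: outflow_outside gout_outside)
qed

lemma weight_nonneg: "0 \<le> weight \<alpha>"
  by (simp add: weight_def gout_nonneg)

text \<open>Weights are assigned where arcs end, so the flow is recovered from the last gap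
  backwards; in each step the two \<open>fill\<close> terms cancel against
  \<open>gout\<close>.\<close>

lemma flow_weight: "k \<le> n \<Longrightarrow> flow n weight k p = gflow k p"
proof (induction k arbitrary: p rule: inc_induct)
  case base
  then show ?case by (simp add: flow_last outflow_weight gout_def)
next
  case (step k)
  have "flow n weight k p = gflow (Suc k) (True # p) + gflow (Suc k) (False # p) + gout k p"
    using flow_conservation[of k n weight p] step by (simp add: outflow_weight)
  then show ?case using step by (simp add: gout_def)
qed

lemma weight_le_gflow:
  assumes "\<alpha> \<in> wiggly_arcs n" "src \<alpha> \<le> k" "k < tgt \<alpha>"
  shows "weight \<alpha> \<le> gflow k (prefix_word \<alpha> k)"
proof -
  have "k \<le> n" using assms by (simp add: wiggly_arc_iff)
  then show ?thesis
    using total_ge[of n weight \<alpha> "\<lambda>\<beta>. src \<beta> \<le> k \<and> k < tgt \<beta> \<and> prefix_word \<beta> k = prefix_word \<alpha> k"]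
      assms weight_nonneg flow_weight[of k] unfolding flow_def by simp
qed

text \<open>Positive weight ending at \<open>l + 1\<close> needs two different fills, hence
  \<open>t (Suc l) \<noteq> 0\<close>; positive weight starting there needs
  \<open>s (Suc l) > 0\<close>.\<close>

lemma weight_pointed:
  assumes a: "\<alpha> \<in> wiggly_arcs n" "0 < weight \<alpha>" and b: "\<beta> \<in> wiggly_arcs n" "0 < weight \<beta>"
  shows "src \<alpha> \<noteq> tgt \<beta>"
proof
  assume eq: "src \<alpha> = tgt \<beta>"
  obtain l where l: "tgt \<beta> = Suc l" using b(1) by (cases "tgt \<beta>") (auto simp: wiggly_arc_iff)
  have "src \<alpha> < tgt \<alpha>" "tgt \<alpha> \<le> Suc n" using a(1) by (simp_all add: wiggly_arc_iff)
  then have "l < n" using eq l by simp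
  then have "t (Suc l) \<noteq> 0" using b(2) l by (auto simp: weight_def gout_def)
  moreover have "prefix_word \<alpha> (Suc l) = []" unfolding prefix_word_eq_Nil using eq l by simp
  then have "0 < s (Suc l)"
    using weight_le_gflow[OF a(1), of "Suc l"] a(2) eq l \<open>src \<alpha> < tgt \<alpha>\<close> by simp
  ultimately show False using pointed[of "Suc l"] by simp
qed

text \<open>\<open>crossing_height\<close> yields a gap \<open>k\<close> where \<beta> is lower
  although it is strictly over \<alpha> at \<open>k + 1\<close>. If \<beta> passes above, the amount
  passing above has already exhausted the strand of \<alpha>, which can then neither end nor pass
  below. If \<beta> ends, the amount passing above or ending has exhausted it, and \<alpha> cannot
  pass below.\<close>

lemma weight_not_crossing:
  assumes a: "\<alpha> \<in> wiggly_arcs n" "0 < weight \<alpha>" and b: "\<beta> \<in> wiggly_arcs n" "0 < weight \<beta>"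
    and m: "strictly_over \<alpha> \<beta> m" "strictly_over \<beta> \<alpha> m'" "m < m'"
  shows False
proof -
  obtain k where k: "src \<alpha> \<le> k" "k < tgt \<alpha>" "src \<beta> \<le> k" "k < tgt \<beta>"
    "height (prefix_word \<beta> k) < height (prefix_word \<alpha> k)" "strictly_over \<beta> \<alpha> (Suc k)"
    using crossing_height[OF a(1) b(1) m] by blast
  note so = strictly_overD[OF b(1) a(1) k(6)]
  note mem = wiggly_arc_mem[OF a(1), of "Suc k"] wiggly_arc_mem[OF b(1), of "Suc k"]
  \<comment> \<open>At \<open>n + 1\<close> arcs can only end, and of two endpoints neither is
    strictly over the other.\<close>
  have lt: "k < n"
    using so(8) mem a(1) b(1) unfolding wiggly_arc_iff by linarith
  define p q where "p = prefix_word \<alpha> k" and "q = prefix_word \<beta> k"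
  let ?f = "fill (words k) height (gflow k)"
  have greedy: "?f x p = gflow k p" if "0 < ?f x q" for x
    using fill_greedy[OF finite_words _ _ _ that, of p] prefix_word_in_words gflow_nonneg k(5)
    by (simp add: p_def q_def)
  have mono: "?f (a (Suc k)) r \<le> ?f (a (Suc k) + t (Suc k)) r" for r
    using t_nonneg by (simp add: fill_mono)
  have upper: "?f x r \<le> gflow k r" and lower: "0 \<le> ?f x r" for x r
    using gflow_nonneg by (simp_all add: fill_bounds)
  have a_end: "?f (a (Suc k)) p < ?f (a (Suc k) + t (Suc k)) p" if "tgt \<alpha> = Suc k"
    using a(2) that lt by (simp add: weight_def gout_def p_def)
  have b_end: "?f (a (Suc k)) q < ?f (a (Suc k) + t (Suc k)) q" if "tgt \<beta> = Suc k"
    using b(2) that lt by (simp add: weight_def gout_def q_def)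
  have a_under: "?f (a (Suc k) + t (Suc k)) p < gflow k p" if "Suc k \<in> under_pts \<alpha>"
    using a weight_le_gflow[OF a(1), of "Suc k"] that mem k(1) by (simp add: p_def)
  have b_over: "0 < ?f (a (Suc k)) q" if "Suc k \<in> over_pts \<beta>"
    using b weight_le_gflow[OF b(1), of "Suc k"] that mem k(3) by (simp add: q_def)
  show False
  proof (cases "Suc k \<in> over_pts \<beta>")
    case True
    then have "?f (a (Suc k)) p = gflow k p" using greedy b_over by simp
    moreover have "tgt \<alpha> = Suc k \<or> Suc k \<in> under_pts \<alpha>" using so(7) k(1) by auto
    ultimately show ?thesis
      using a_end a_under mono[of p] upper[of "a (Suc k) + t (Suc k)" p] by linarith
  next
    case False
    then have "Suc k \<in> under_pts \<alpha>" "tgt \<beta> = Suc k" using so(6,8) k(3) by auto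
    then show ?thesis
      using a_under b_end lower[of "a (Suc k)" q] greedy[of "a (Suc k) + t (Suc k)"] by linarith
  qed
qed

lemma lamination_weight: "lamination n weight"
  unfolding lamination_def
proof (intro conjI ballI pairwiseI weight_nonneg)
  fix \<alpha> \<beta> assume "\<alpha> \<in> {\<alpha> \<in> wiggly_arcs n. 0 < weight \<alpha>}" "\<beta> \<in> {\<alpha> \<in> wiggly_arcs n. 0 < weight \<alpha>}"
  then have a: "\<alpha> \<in> wiggly_arcs n" "0 < weight \<alpha>" and b: "\<beta> \<in> wiggly_arcs n" "0 < weight \<beta>"
    by simp_all
  have False if m: "strictly_over \<alpha> \<beta> m" "strictly_over \<beta> \<alpha> m'" for m m'
  proof (cases m m' rule: linorder_cases)
    case less
    then show ?thesis using weight_not_crossing[OF a b m] by simp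
  next
    case equal
    then show ?thesis
      using strictly_overD(8)[OF a(1) b(1) m(1)] strictly_overD(6,7)[OF b(1) a(1) m(2)[folded equal]]
        strictly_overD(6,7)[OF a(1) b(1) m(1)] wiggly_arc_mem[OF a(1), of m] wiggly_arc_mem[OF b(1), of m]
      by auto
  next
    case greater
    then show ?thesis using weight_not_crossing[OF b a m(2,1)] by simp
  qed
  then show "compatible \<alpha> \<beta>"
    using weight_pointed[OF a b] weight_pointed[OF b a] unfolding compatible_iff by blast
qed

lemma total_weight_over:
  assumes "l < n"
  shows "total_weight n weight (\<lambda>\<alpha>. Suc l \<in> over_pts \<alpha>) = a (Suc l)"
  using sum_flow_True[where n = n and c = weight and l = l] sum_fill_gflow(1)[OF assms] sum_gflow[of l] assms
  by (simp add: flow_weight)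

lemma total_weight_under:
  assumes "l < n"
  shows "total_weight n weight (\<lambda>\<alpha>. Suc l \<in> under_pts \<alpha>) =
    s 0 + (\<Sum>k = 1..l. s k - t k) - t (Suc l) - a (Suc l)"
  using sum_flow_False[where n = n and c = weight and l = l] sum_fill_gflow(2)[OF assms] sum_gflow[of l] assms
  by (simp add: flow_weight sum_subtractf)

lemma total_weight_src:
  assumes "l < n"
  shows "total_weight n weight (\<lambda>\<alpha>. src \<alpha> = Suc l) = s (Suc l)"
  using flow_Nil[of n weight "Suc l"] assms by (simp add: flow_weight)

lemma total_weight_tgt:
  assumes "l < n"
  shows "total_weight n weight (\<lambda>\<alpha>. tgt \<alpha> = Suc l) = t (Suc l)"
  using sum_outflow[where n = n and c = weight and l = l] sum_fill_gflow[OF assms] sum_gflow[of l] assms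
  by (simp add: outflow_weight gout_def sum_subtractf)

end

lemma lamination_exists:
  fixes h d :: "nat \<Rightarrow> real"
  obtains c where "lamination n c"
    and "\<And>k. 1 \<le> k \<Longrightarrow> k \<le> n \<Longrightarrow>
      total_weight n c (\<lambda>\<alpha>. k \<in> over_pts \<alpha>) - total_weight n c (\<lambda>\<alpha>. k \<in> under_pts \<alpha>) = h k"
    and "\<And>k. 1 \<le> k \<Longrightarrow> k \<le> n \<Longrightarrow>
      total_weight n c (\<lambda>\<alpha>. src \<alpha> = k) - total_weight n c (\<lambda>\<alpha>. tgt \<alpha> = k) = d k"
proof -
  \<comment> \<open>The weight leaving 0 is chosen so large that at each point \<open>k\<close> the
    arriving weight is at least \<open>t k\<close> plus the absolute value of \<open>h k\<close>;
    this is the fact \<open>bound\<close>.\<close>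
  define N where "N = (\<Sum>k = 1..n. \<bar>h k\<bar> + \<bar>d k\<bar>)"
  \<comment> \<open>From the point 1 on, \<open>s\<close> and \<open>t\<close> are the positive and
    negative parts of \<open>d\<close>, so one of them vanishes.\<close>
  define s where "s k = (if k = 0 then N else max (d k) 0)" for k
  define t where "t k = (if k = 0 then 0 else max (- d k) 0)" for k
  define T where "T l = N + (\<Sum>k = 1..l. d k)" for l
  \<comment> \<open>With \<open>b\<close> the weight passing below, this solves
    \<open>a - b = h\<close> and \<open>a + b + t = T\<close> at the point \<open>k\<close>, where
    \<open>T (k - 1)\<close> is the weight arriving through the gap before it.\<close>
  define a where "a k = (T (k - 1) - t k + h k) / 2" for k
  have N: "0 \<le> N" by (simp add: N_def sum_nonneg)
  have st: "s k - t k = d k" if "1 \<le> k" for k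
    using that by (auto simp: s_def t_def)
  have T: "s 0 + (\<Sum>k = 1..l. s k - t k) = T l" for l
    by (simp add: T_def s_def[of 0] st)
  have bound: "\<bar>h (Suc l)\<bar> + t (Suc l) \<le> T l" if l: "l < n" for l
  proof -
    have "(\<Sum>k = 1..Suc l. \<bar>h k\<bar> + \<bar>d k\<bar>) \<le> N"
      unfolding N_def using l by (intro sum_mono2) auto
    moreover have "- (\<Sum>k = 1..l. d k) \<le> (\<Sum>k = 1..l. \<bar>h k\<bar> + \<bar>d k\<bar>)"
      unfolding sum_negf[symmetric] by (intro sum_mono) linarith
    moreover have "t (Suc l) \<le> \<bar>d (Suc l)\<bar>" by (simp add: t_def)
    ultimately show ?thesis by (simp add: T_def)
  qed
  interpret greedy_flow n s t a
  proof
    show "0 \<le> s k" "0 \<le> t k" "s k = 0 \<or> t k = 0" for k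
      using N by (auto simp: s_def t_def)
    show "0 \<le> a (Suc l)" if "l < n" for l
      using bound[OF that] by (simp add: a_def)
    show "a (Suc l) + t (Suc l) \<le> s 0 + (\<Sum>k = 1..l. s k - t k)" if "l < n" for l
      unfolding T using bound[OF that] by (simp add: a_def field_simps)
  qed
  show ?thesis
  proof (rule that[OF lamination_weight])
    fix k assume k: "1 \<le> k" "k \<le> n"
    then obtain l where l: "k = Suc l" "l < n" by (cases k) auto
    show "total_weight n weight (\<lambda>\<alpha>. k \<in> over_pts \<alpha>) - total_weight n weight (\<lambda>\<alpha>. k \<in> under_pts \<alpha>) = h k"
      unfolding l(1) total_weight_over[OF l(2)] total_weight_under[OF l(2)] T by (simp add: a_def field_simps)
    show "total_weight n weight (\<lambda>\<alpha>. src \<alpha> = k) - total_weight n weight (\<lambda>\<alpha>. tgt \<alpha> = k) = d k"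
      unfolding l(1) total_weight_src[OF l(2)] total_weight_tgt[OF l(2)] by (simp add: st)
  qed
qed



section \<open>g-vectors as coordinates of laminations\<close>

definition raw_g_vec :: "nat \<Rightarrow> (nat \<Rightarrow> 'a::euclidean_space) \<Rightarrow> arc \<Rightarrow> 'a" where
  "raw_g_vec n e \<alpha> = char_vec e (arc_plus n \<alpha>) - char_vec e (arc_minus n \<alpha>)"

definition top_arc :: "nat \<Rightarrow> arc" where "top_arc n = (0, n + 1, {1..n}, {})"
definition bottom_arc :: "nat \<Rightarrow> arc" where "bottom_arc n = (0, n + 1, {}, {1..n})"

lemma external_arcs_eq: "external_arcs n = {top_arc n, bottom_arc n}"
  by (simp add: external_arcs_def top_arc_def bottom_arc_def)

lemma external_in_wiggly_arcs: "top_arc n \<in> wiggly_arcs n" "bottom_arc n \<in> wiggly_arcs n"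
  by (auto simp: wiggly_arc_iff top_arc_def bottom_arc_def)

lemma compatible_sym: "compatible \<alpha> \<beta> \<Longrightarrow> compatible \<beta> \<alpha>"
  unfolding compatible_iff by auto

text \<open>No arc is strictly over the top arc and the bottom arc is strictly over none, so one
  half of a crossing always fails; and no arc ends at 0 or starts at \<open>n + 1\<close>.\<close>

lemma compatible_external:
  assumes "\<alpha> \<in> external_arcs n" "\<beta> \<in> wiggly_arcs n"
  shows "compatible \<alpha> \<beta>"
proof -
  have b: "src \<beta> < tgt \<beta>" "tgt \<beta> \<le> Suc n" using assms(2) by (simp_all add: wiggly_arc_iff)
  note mem = wiggly_arc_mem[OF assms(2)]
  have "\<not> strictly_over \<beta> (top_arc n) k" "\<not> strictly_over (bottom_arc n) \<beta> k" for k
    using mem[of k] b by (auto simp: strictly_over_def top_arc_def bottom_arc_def)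
  moreover have "src \<alpha> = 0" "tgt \<alpha> = Suc n" "\<alpha> = top_arc n \<or> \<alpha> = bottom_arc n"
    using assms(1) by (auto simp: external_arcs_eq top_arc_def bottom_arc_def)
  ultimately show ?thesis using b unfolding compatible_iff by auto
qed

lemma arc_plus_minus_subset:
  assumes "\<alpha> \<in> wiggly_arcs n"
  shows "arc_plus n \<alpha> \<subseteq> {1..2 * n}" "arc_minus n \<alpha> \<subseteq> {1..2 * n}"
proof -
  obtain i j A B where \<alpha>: "\<alpha> = (i, j, A, B)" by (cases \<alpha>)
  have ij: "i < j" "j \<le> Suc n" using assms by (simp_all add: \<alpha> wiggly_arcs_def)
  have AB: "k \<in> A \<or> k \<in> B \<Longrightarrow> 1 \<le> k \<and> k \<le> n" for k
    using wiggly_arc_mem[OF assms, of k] ij by (auto simp: \<alpha>)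
  show "arc_plus n \<alpha> \<subseteq> {1..2 * n}" "arc_minus n \<alpha> \<subseteq> {1..2 * n}"
    using ij by (auto simp: \<alpha> dest!: AB[OF disjI1] AB[OF disjI2])
qed

lemma mem_arc_plus_minus:
  assumes k: "1 \<le> k" "k \<le> n"
  shows "2 * k - 1 \<in> arc_plus n \<alpha> \<longleftrightarrow> src \<alpha> = k \<or> k \<in> over_pts \<alpha>"
    and "2 * k \<in> arc_plus n \<alpha> \<longleftrightarrow> tgt \<alpha> = k \<or> k \<in> over_pts \<alpha>"
    and "2 * k - 1 \<in> arc_minus n \<alpha> \<longleftrightarrow> tgt \<alpha> = k \<or> k \<in> under_pts \<alpha>"
    and "2 * k \<in> arc_minus n \<alpha> \<longleftrightarrow> src \<alpha> = k \<or> k \<in> under_pts \<alpha>"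
proof -
  obtain i j A B where \<alpha>: "\<alpha> = (i, j, A, B)" by (cases \<alpha>)
  \<comment> \<open>For \<open>m = 0\<close> the truncated \<open>2 * m - 1\<close> is 0, which is
    not hit since \<open>k \<ge> 1\<close>.\<close>
  have odd: "2 * k - 1 = 2 * m - 1 \<longleftrightarrow> m = k" "2 * k - 1 \<noteq> 2 * m" "2 * k - 1 \<noteq> 0"
      "2 * k - 1 \<noteq> 2 * n + 1" "2 * k - 1 \<noteq> 2 * n + 2" for m
    using k by presburger+
  have even: "2 * k = 2 * m \<longleftrightarrow> m = k" "2 * k \<noteq> 2 * m - 1" "2 * k \<noteq> 0"
      "2 * k \<noteq> 2 * n + 1" "2 * k \<noteq> 2 * n + 2" for m
    using k by presburger+
  have odd_UN: "2 * k - 1 \<in> (\<Union>a\<in>X. {2 * a - 1, 2 * a}) \<longleftrightarrow> k \<in> X" for X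
    by (simp only: UN_iff insert_iff empty_iff odd simp_thms bex_triv_one_point1)
  have even_UN: "2 * k \<in> (\<Union>a\<in>X. {2 * a - 1, 2 * a}) \<longleftrightarrow> k \<in> X" for X
    by (simp only: UN_iff insert_iff empty_iff even simp_thms bex_triv_one_point1)
  show "2 * k - 1 \<in> arc_plus n \<alpha> \<longleftrightarrow> src \<alpha> = k \<or> k \<in> over_pts \<alpha>"
    "2 * k - 1 \<in> arc_minus n \<alpha> \<longleftrightarrow> tgt \<alpha> = k \<or> k \<in> under_pts \<alpha>"
    by (simp_all only: \<alpha> arc_plus.simps arc_minus.simps arc_components Un_iff Diff_iff
        insert_iff empty_iff odd_UN odd simp_thms)
  show "2 * k \<in> arc_plus n \<alpha> \<longleftrightarrow> tgt \<alpha> = k \<or> k \<in> over_pts \<alpha>"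
    "2 * k \<in> arc_minus n \<alpha> \<longleftrightarrow> src \<alpha> = k \<or> k \<in> under_pts \<alpha>"
    by (simp_all only: \<alpha> arc_plus.simps arc_minus.simps arc_components Un_iff Diff_iff
        insert_iff empty_iff even_UN even simp_thms)
qed

lemma total_weight_of_bool: "total_weight n c P = (\<Sum>\<alpha>\<in>wiggly_arcs n. c \<alpha> * of_bool (P \<alpha>))"
  unfolding total_weight_def using finite_wiggly_arcs
  by (intro sum.mono_neutral_cong_left) auto

lemma index_cases:
  fixes m n :: nat
  assumes "m \<in> {1..2 * n}"
  obtains k where "1 \<le> k" "k \<le> n" "m = 2 * k - 1 \<or> m = 2 * k"
proof
  show "1 \<le> (m + 1) div 2" "(m + 1) div 2 \<le> n"
    "m = 2 * ((m + 1) div 2) - 1 \<or> m = 2 * ((m + 1) div 2)"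
    using assms unfolding atLeastAtMost_iff by presburger+
qed

lemma eq_of_sum_diff_eq:
  fixes x y x' y' :: real
  assumes "x + y = x' + y'" "x - y = x' - y'"
  shows "x = x'" "y = y'"
  using assms by linarith+

text \<open>Provides the external weights for \<open>g_decomposition_unique\<close>. The two
  equations fix \<open>p - p'\<close> and \<open>q - q'\<close>, and every real number is a
  difference of two nonnegative ones.\<close>

lemma nonneg_sum_diff_parts:
  fixes u x y :: real
  obtains p p' q q' where "0 \<le> p" "0 \<le> p'" "0 \<le> q" "0 \<le> q'"
    "p - q + u = p' - q'" "p + q + x = p' + q' + y"
proof -
  have parts: "\<exists>p p'. 0 \<le> p \<and> 0 \<le> p' \<and> z = p - p'" for z :: real
    by (rule exI[of _ "max z 0"], rule exI[of _ "max (- z) 0"]) simp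
  obtain p p' where p: "0 \<le> p" "0 \<le> p'" "(y - x - u) / 2 = p - p'" using parts by blast
  obtain q q' where q: "0 \<le> q" "0 \<le> q'" "(y - x + u) / 2 = q - q'" using parts by blast
  show ?thesis
    using that[OF p(1,2) q(1,2)] p(3) q(3) by (simp add: field_simps)
qed

section \<open>Coordinates of weighted sums, the projection and the external arcs\<close>

context
  fixes n :: nat and e :: "nat \<Rightarrow> 'a::euclidean_space"
  assumes n: "n \<ge> 1" and e: "bij_betw e {1..2 * n} Basis"
begin

lemma inner_char_vec:
  assumes "X \<subseteq> {1..2 * n}" and m: "m \<in> {1..2 * n}"
  shows "char_vec e X \<bullet> e m = of_bool (m \<in> X)"
proof -
  have "e k \<bullet> e m = of_bool (k = m)" if k: "k \<in> {1..2 * n}" for k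
    using inner_Basis[OF bij_betwE[OF e, rule_format, OF k] bij_betwE[OF e, rule_format, OF m]]
      inj_on_eq_iff[OF bij_betw_imp_inj_on[OF e] k m] by simp
  then have "char_vec e X \<bullet> e m = (\<Sum>k\<in>X. of_bool (k = m))"
    unfolding char_vec_def inner_sum_left using assms(1) by (intro sum.cong) auto
  then show ?thesis
    using finite_subset[OF assms(1)] by (simp add: of_bool_def)
qed

lemma coordinate_eqI:
  assumes "\<And>k. 1 \<le> k \<Longrightarrow> k \<le> n \<Longrightarrow> x \<bullet> e (2 * k - 1) = y \<bullet> e (2 * k - 1) \<and> x \<bullet> e (2 * k) = y \<bullet> e (2 * k)"
  shows "x = y"
proof (rule euclidean_eqI)
  fix b :: 'a assume "b \<in> Basis"
  then obtain m where m: "m \<in> {1..2 * n}" "b = e m"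
    using bij_betw_imp_surj_on[OF e] by blast
  then show "x \<bullet> b = y \<bullet> b" using assms index_cases[OF m(1)] by metis
qed

lemma inner_raw_g_vec:
  assumes \<alpha>: "\<alpha> \<in> wiggly_arcs n" and k: "1 \<le> k" "k \<le> n"
  shows "raw_g_vec n e \<alpha> \<bullet> e (2 * k - 1) = of_bool (k \<in> over_pts \<alpha>) - of_bool (k \<in> under_pts \<alpha>)
      + of_bool (src \<alpha> = k) - of_bool (tgt \<alpha> = k)"
    and "raw_g_vec n e \<alpha> \<bullet> e (2 * k) = of_bool (k \<in> over_pts \<alpha>) - of_bool (k \<in> under_pts \<alpha>)
      - of_bool (src \<alpha> = k) + of_bool (tgt \<alpha> = k)"
proof -
  have "2 * k - 1 \<in> {1..2 * n}" "2 * k \<in> {1..2 * n}" using k by auto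
  note char = this[THEN inner_char_vec[OF arc_plus_minus_subset(1)[OF \<alpha>]]]
    this[THEN inner_char_vec[OF arc_plus_minus_subset(2)[OF \<alpha>]]]
  show "raw_g_vec n e \<alpha> \<bullet> e (2 * k - 1) = of_bool (k \<in> over_pts \<alpha>) - of_bool (k \<in> under_pts \<alpha>)
      + of_bool (src \<alpha> = k) - of_bool (tgt \<alpha> = k)"
    "raw_g_vec n e \<alpha> \<bullet> e (2 * k) = of_bool (k \<in> over_pts \<alpha>) - of_bool (k \<in> under_pts \<alpha>)
      - of_bool (src \<alpha> = k) + of_bool (tgt \<alpha> = k)"
    unfolding raw_g_vec_def inner_diff_left char mem_arc_plus_minus[OF k]
    using wiggly_arc_mem[OF \<alpha>, of k] by auto
qed

text \<open>Half the sum and half the difference of the two coordinates at \<open>k\<close> are the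
  quantities that \<open>lamination_unique\<close> and \<open>lamination_exists\<close> take as
  data.\<close>

lemma inner_sum_raw_g_vec:
  assumes k: "1 \<le> k" "k \<le> n"
  shows "(\<Sum>\<alpha>\<in>wiggly_arcs n. c \<alpha> *\<^sub>R raw_g_vec n e \<alpha>) \<bullet> e (2 * k - 1) =
      total_weight n c (\<lambda>\<alpha>. k \<in> over_pts \<alpha>) - total_weight n c (\<lambda>\<alpha>. k \<in> under_pts \<alpha>)
      + (total_weight n c (\<lambda>\<alpha>. src \<alpha> = k) - total_weight n c (\<lambda>\<alpha>. tgt \<alpha> = k))"
    and "(\<Sum>\<alpha>\<in>wiggly_arcs n. c \<alpha> *\<^sub>R raw_g_vec n e \<alpha>) \<bullet> e (2 * k) =
      total_weight n c (\<lambda>\<alpha>. k \<in> over_pts \<alpha>) - total_weight n c (\<lambda>\<alpha>. k \<in> under_pts \<alpha>)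
      - (total_weight n c (\<lambda>\<alpha>. src \<alpha> = k) - total_weight n c (\<lambda>\<alpha>. tgt \<alpha> = k))"
  unfolding total_weight_of_bool inner_sum_left sum_subtractf[symmetric] sum.distrib[symmetric]
  by (intro sum.cong refl; simp only: inner_scaleR_left inner_raw_g_vec[OF _ k]; simp add: algebra_simps)+

abbreviation "ones \<equiv> char_vec e {1..2 * n}"

lemma inner_ones: "m \<in> {1..2 * n} \<Longrightarrow> ones \<bullet> e m = 1"
  using inner_char_vec[of "{1..2 * n}" m] by simp

lemma ones_inner_ones: "ones \<bullet> ones = 2 * real n"
proof -
  have "ones \<bullet> ones = (\<Sum>m\<in>{1..2 * n}. ones \<bullet> e m)"
    by (subst (2) char_vec_def) (simp add: inner_sum_right)
  also have "\<dots> = (\<Sum>m\<in>{1..2 * n}. 1)"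
    by (intro sum.cong refl inner_ones)
  finally show ?thesis by simp
qed

lemma hyperplane_iff: "x \<in> sum_zero_hyperplane n e \<longleftrightarrow> x \<bullet> ones = 0"
  by (simp add: sum_zero_hyperplane_def char_vec_def inner_sum_right)

lemma subspace_hyperplane: "subspace (sum_zero_hyperplane n e)"
  by (auto simp: subspace_def hyperplane_iff inner_add_left)

lemma linear_proj: "linear (proj_sum_zero n e)"
  by (rule linearI) (simp_all add: proj_sum_zero_def inner_add_left add_divide_distrib algebra_simps)

lemma proj_in_hyperplane: "proj_sum_zero n e x \<in> sum_zero_hyperplane n e"
  unfolding hyperplane_iff proj_sum_zero_def inner_diff_left inner_scaleR_left ones_inner_ones
  using n by simp

lemma proj_ones: "proj_sum_zero n e ones = 0"
  unfolding proj_sum_zero_def ones_inner_ones using n by simp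

lemma proj_hyperplane: "x \<in> sum_zero_hyperplane n e \<Longrightarrow> proj_sum_zero n e x = x"
  by (simp add: hyperplane_iff proj_sum_zero_def)

lemma g_vec_eq_proj: "g_vec n e \<alpha> = proj_sum_zero n e (raw_g_vec n e \<alpha>)"
  by (simp add: g_vec_def raw_g_vec_def)

lemma proj_sum_raw_g_vec:
  "proj_sum_zero n e (\<Sum>\<alpha>\<in>D. c \<alpha> *\<^sub>R raw_g_vec n e \<alpha>) = (\<Sum>\<alpha>\<in>D. c \<alpha> *\<^sub>R g_vec n e \<alpha>)"
  by (simp add: linear_sum[OF linear_proj] linear_scale[OF linear_proj] g_vec_eq_proj)

lemma raw_g_vec_external: "raw_g_vec n e (top_arc n) = ones" "raw_g_vec n e (bottom_arc n) = - ones"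
proof -
  have "m \<in> (\<Union>a\<in>{1..n}. {2 * a - 1, 2 * a}) \<longleftrightarrow> m \<in> {1..2 * n}" for m
  proof
    assume "m \<in> {1..2 * n}"
    then obtain k where "1 \<le> k" "k \<le> n" "m = 2 * k - 1 \<or> m = 2 * k" by (rule index_cases)
    then show "m \<in> (\<Union>a\<in>{1..n}. {2 * a - 1, 2 * a})" by auto
  qed auto
  then have U: "(\<Union>a\<in>{1..n}. {2 * a - 1, 2 * a}) = {1..2 * n}" by blast
  have "arc_plus n (top_arc n) = {1..2 * n}" "arc_minus n (top_arc n) = {}"
    "arc_plus n (bottom_arc n) = {}" "arc_minus n (bottom_arc n) = {1..2 * n}"
    unfolding top_arc_def bottom_arc_def arc_plus.simps arc_minus.simps U by auto
  then show "raw_g_vec n e (top_arc n) = ones" "raw_g_vec n e (bottom_arc n) = - ones"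
    by (simp_all add: raw_g_vec_def char_vec_def)
qed

lemma wiggly_arcs_split:
  "wiggly_arcs n = insert (top_arc n) (insert (bottom_arc n) (internal_arcs n))"
  "top_arc n \<notin> insert (bottom_arc n) (internal_arcs n)" "bottom_arc n \<notin> internal_arcs n"
proof -
  show "wiggly_arcs n = insert (top_arc n) (insert (bottom_arc n) (internal_arcs n))"
    using external_in_wiggly_arcs by (auto simp: internal_arcs_def external_arcs_eq)
  \<comment> \<open>For \<open>n = 0\<close> the two external arcs would coincide;
    \<open>n \<ge> 1\<close> keeps them distinct.\<close>
  show "top_arc n \<notin> insert (bottom_arc n) (internal_arcs n)" "bottom_arc n \<notin> internal_arcs n"
    using n by (auto simp: internal_arcs_def external_arcs_eq) (auto simp: top_arc_def bottom_arc_def)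
qed

lemma finite_internal_arcs: "finite (internal_arcs n)"
  using finite_wiggly_arcs by (simp add: internal_arcs_def)

lemma sum_wiggly_arcs:
  "sum f (wiggly_arcs n) = f (top_arc n) + (f (bottom_arc n) + sum f (internal_arcs n))"
  using wiggly_arcs_split finite_internal_arcs by simp

text \<open>The external weights \<open>p\<close> and \<open>q\<close> can be chosen so as to change both the multiple of the
  all-ones vector killed by the projection (by \<open>p - q\<close>) and the total weight leaving the point
  \<open>0\<close> (by \<open>p + q\<close>) by any prescribed amounts.\<close>

definition extend :: "real \<Rightarrow> real \<Rightarrow> (arc \<Rightarrow> real) \<Rightarrow> arc \<Rightarrow> real" where
  "extend p q c \<alpha> = (if \<alpha> = top_arc n then p else if \<alpha> = bottom_arc n then q else c \<alpha>)"

lemma extend_simps: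
  "extend p q c (top_arc n) = p" "extend p q c (bottom_arc n) = q"
  "\<alpha> \<in> internal_arcs n \<Longrightarrow> extend p q c \<alpha> = c \<alpha>"
  using wiggly_arcs_split(2,3) by (auto simp: extend_def)

lemma lamination_extend:
  assumes p: "0 \<le> p" "0 \<le> q" and c: "\<forall>\<alpha>\<in>internal_arcs n. 0 \<le> c \<alpha>"
    and D: "{\<alpha>\<in>internal_arcs n. 0 < c \<alpha>} \<in> wiggly_complex n"
  shows "lamination n (extend p q c)"
  unfolding lamination_def
proof (intro conjI ballI pairwiseI)
  fix \<alpha> assume "\<alpha> \<in> wiggly_arcs n"
  then show "0 \<le> extend p q c \<alpha>"
    using p c unfolding wiggly_arcs_split(1) by (auto simp: extend_simps)
next
  fix \<alpha> \<beta> assume ab: "\<alpha> \<in> {\<alpha>\<in>wiggly_arcs n. 0 < extend p q c \<alpha>}" "\<beta> \<in> {\<alpha>\<in>wiggly_arcs n. 0 < extend p q c \<alpha>}" "\<alpha> \<noteq> \<beta>"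
  consider "\<alpha> \<in> external_arcs n" | "\<beta> \<in> external_arcs n" | "\<alpha> \<in> internal_arcs n" "\<beta> \<in> internal_arcs n"
    using ab by (auto simp: internal_arcs_def)
  then show "compatible \<alpha> \<beta>"
  proof cases
    case 1
    then show ?thesis using ab compatible_external by simp
  next
    case 2
    then show ?thesis using ab compatible_external compatible_sym by simp
  next
    case 3
    then have "\<alpha> \<in> {\<alpha>\<in>internal_arcs n. 0 < c \<alpha>}" "\<beta> \<in> {\<alpha>\<in>internal_arcs n. 0 < c \<alpha>}"
      using ab by (simp_all add: extend_simps)
    moreover have "pairwise compatible {\<alpha>\<in>internal_arcs n. 0 < c \<alpha>}"
      using D by (simp add: wiggly_complex_def)
    ultimately show ?thesis using ab(3) pairwiseD by fast
  qed
qed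

text \<open>The kernel of the projection is the line of the all-ones vector.\<close>

lemma proj_eqD:
  assumes "proj_sum_zero n e x = proj_sum_zero n e y"
  obtains u where "x = y + u *\<^sub>R ones"
proof
  show "x = y + ((x \<bullet> ones) / real (2 * n) - (y \<bullet> ones) / real (2 * n)) *\<^sub>R ones"
    using assms unfolding proj_sum_zero_def by (simp only: algebra_simps)
qed

lemma sum_extend:
  "(\<Sum>\<alpha>\<in>wiggly_arcs n. extend p q c \<alpha> *\<^sub>R raw_g_vec n e \<alpha>) =
     (p - q) *\<^sub>R ones + (\<Sum>\<alpha>\<in>internal_arcs n. c \<alpha> *\<^sub>R raw_g_vec n e \<alpha>)"
  by (simp add: sum_wiggly_arcs extend_simps raw_g_vec_external scaleR_diff_left)

lemma total_weight_extend_src: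
  "total_weight n (extend p q c) (\<lambda>\<alpha>. src \<alpha> = 0) =
     p + q + (\<Sum>\<alpha>\<in>internal_arcs n. c \<alpha> * of_bool (src \<alpha> = 0))"
proof -
  have "src (top_arc n) = 0" "src (bottom_arc n) = 0" by (simp_all add: top_arc_def bottom_arc_def)
  then show ?thesis
    unfolding total_weight_of_bool sum_wiggly_arcs by (simp add: extend_simps)
qed

lemma lamination_unique_of_sum:
  assumes lam: "lamination n c" "lamination n d"
    and start: "total_weight n c (\<lambda>\<alpha>. src \<alpha> = 0) = total_weight n d (\<lambda>\<alpha>. src \<alpha> = 0)"
    and sum: "(\<Sum>\<alpha>\<in>wiggly_arcs n. c \<alpha> *\<^sub>R raw_g_vec n e \<alpha>) = (\<Sum>\<alpha>\<in>wiggly_arcs n. d \<alpha> *\<^sub>R raw_g_vec n e \<alpha>)"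
    and \<alpha>: "\<alpha> \<in> wiggly_arcs n"
  shows "c \<alpha> = d \<alpha>"
proof -
  let ?h = "\<lambda>c k. total_weight n c (\<lambda>\<alpha>. k \<in> over_pts \<alpha>) - total_weight n c (\<lambda>\<alpha>. k \<in> under_pts \<alpha>)"
  let ?d = "\<lambda>c k. total_weight n c (\<lambda>\<alpha>. src \<alpha> = k) - total_weight n c (\<lambda>\<alpha>. tgt \<alpha> = k)"
  have coord: "?h c k + ?d c k = ?h d k + ?d d k" "?h c k - ?d c k = ?h d k - ?d d k"
    if "1 \<le> k" "k \<le> n" for k
    unfolding inner_sum_raw_g_vec[OF that, symmetric] sum by (rule refl)+
  have pass: "?h c k = ?h d k" and ends: "?d c k = ?d d k" if "1 \<le> k" "k \<le> n" for k
    by (rule eq_of_sum_diff_eq(1)[OF coord[OF that]], rule eq_of_sum_diff_eq(2)[OF coord[OF that]])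
  show ?thesis by (rule lamination_unique[OF lam start pass ends \<alpha>])
qed

text \<open>Before projection the two sums differ by a multiple \<open>u\<close> of the all-ones
  vector, and the weights leaving 0 may differ as well. Suitable external weights on both sides
  remove both discrepancies, and uniqueness of laminations applies.\<close>

lemma g_decomposition_unique:
  assumes c: "\<forall>\<alpha>\<in>internal_arcs n. 0 \<le> c \<alpha>" "{\<alpha>\<in>internal_arcs n. 0 < c \<alpha>} \<in> wiggly_complex n"
    and d: "\<forall>\<alpha>\<in>internal_arcs n. 0 \<le> d \<alpha>" "{\<alpha>\<in>internal_arcs n. 0 < d \<alpha>} \<in> wiggly_complex n"
    and eq: "(\<Sum>\<alpha>\<in>internal_arcs n. c \<alpha> *\<^sub>R g_vec n e \<alpha>) = (\<Sum>\<alpha>\<in>internal_arcs n. d \<alpha> *\<^sub>R g_vec n e \<alpha>)"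
    and \<alpha>: "\<alpha> \<in> internal_arcs n"
  shows "c \<alpha> = d \<alpha>"
proof -
  let ?X = "\<lambda>c. \<Sum>\<alpha>\<in>internal_arcs n. c \<alpha> *\<^sub>R raw_g_vec n e \<alpha>"
  let ?N = "\<lambda>c :: arc \<Rightarrow> real. \<Sum>\<alpha>\<in>internal_arcs n. c \<alpha> * of_bool (src \<alpha> = 0)"
  have "proj_sum_zero n e (?X c) = proj_sum_zero n e (?X d)"
    using eq unfolding proj_sum_raw_g_vec .
  then obtain u where u: "?X c = ?X d + u *\<^sub>R ones" by (rule proj_eqD)
  obtain p p' q q' where nonneg: "0 \<le> p" "0 \<le> p'" "0 \<le> q" "0 \<le> q'"
    and pq: "p - q + u = p' - q'" "p + q + ?N c = p' + q' + ?N d"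
    by (rule nonneg_sum_diff_parts)
  have "extend p q c \<alpha> = extend p' q' d \<alpha>"
  proof (rule lamination_unique_of_sum)
    show "lamination n (extend p q c)" "lamination n (extend p' q' d)"
      using nonneg c d by (simp_all add: lamination_extend)
    show "total_weight n (extend p q c) (\<lambda>\<alpha>. src \<alpha> = 0) = total_weight n (extend p' q' d) (\<lambda>\<alpha>. src \<alpha> = 0)"
      unfolding total_weight_extend_src by (rule pq)
    show "(\<Sum>\<alpha>\<in>wiggly_arcs n. extend p q c \<alpha> *\<^sub>R raw_g_vec n e \<alpha>) =
        (\<Sum>\<alpha>\<in>wiggly_arcs n. extend p' q' d \<alpha> *\<^sub>R raw_g_vec n e \<alpha>)"
      unfolding sum_extend u pq(1)[symmetric] by (simp add: scaleR_add_left)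
    show "\<alpha> \<in> wiggly_arcs n" using \<alpha> by (simp add: internal_arcs_def)
  qed
  then show ?thesis using \<alpha> by (simp add: extend_simps)
qed

text \<open>The vector \<open>x\<close> itself is realised by a lamination. The projection fixes
  \<open>x\<close> and kills the external terms, so dropping them leaves a decomposition over a
  face.\<close>

lemma g_decomposition_exists:
  assumes x: "x \<in> sum_zero_hyperplane n e"
  shows "\<exists>c. (\<forall>\<alpha>\<in>internal_arcs n. 0 \<le> c \<alpha>) \<and> {\<alpha>\<in>internal_arcs n. 0 < c \<alpha>} \<in> wiggly_complex n \<and>
    x = (\<Sum>\<alpha>\<in>internal_arcs n. c \<alpha> *\<^sub>R g_vec n e \<alpha>)"
proof -
  \<comment> \<open>Chosen so that the two coordinates at \<open>k\<close> are
    \<open>h k + d k\<close> and \<open>h k - d k\<close>.\<close>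
  define h where "h k = (x \<bullet> e (2 * k - 1) + x \<bullet> e (2 * k)) / 2" for k
  define d where "d k = (x \<bullet> e (2 * k - 1) - x \<bullet> e (2 * k)) / 2" for k
  obtain c where lam: "lamination n c"
    and c: "\<And>k. 1 \<le> k \<Longrightarrow> k \<le> n \<Longrightarrow>
      total_weight n c (\<lambda>\<alpha>. k \<in> over_pts \<alpha>) - total_weight n c (\<lambda>\<alpha>. k \<in> under_pts \<alpha>) = h k"
      "\<And>k. 1 \<le> k \<Longrightarrow> k \<le> n \<Longrightarrow>
      total_weight n c (\<lambda>\<alpha>. src \<alpha> = k) - total_weight n c (\<lambda>\<alpha>. tgt \<alpha> = k) = d k"
    using lamination_exists[of n h d] by blast
  have "x = (\<Sum>\<alpha>\<in>wiggly_arcs n. c \<alpha> *\<^sub>R raw_g_vec n e \<alpha>)"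
  proof (rule coordinate_eqI)
    fix k assume k: "1 \<le> k" "k \<le> n"
    show "x \<bullet> e (2 * k - 1) = (\<Sum>\<alpha>\<in>wiggly_arcs n. c \<alpha> *\<^sub>R raw_g_vec n e \<alpha>) \<bullet> e (2 * k - 1) \<and>
        x \<bullet> e (2 * k) = (\<Sum>\<alpha>\<in>wiggly_arcs n. c \<alpha> *\<^sub>R raw_g_vec n e \<alpha>) \<bullet> e (2 * k)"
      unfolding inner_sum_raw_g_vec[OF k] c[OF k] by (simp add: h_def d_def field_simps)
  qed
  then have "x = (\<Sum>\<alpha>\<in>wiggly_arcs n. c \<alpha> *\<^sub>R g_vec n e \<alpha>)"
    using proj_hyperplane[OF x] proj_sum_raw_g_vec[of c "wiggly_arcs n"] by simp
  moreover have "g_vec n e (top_arc n) = 0" "g_vec n e (bottom_arc n) = 0"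
    unfolding g_vec_eq_proj raw_g_vec_external linear_neg[OF linear_proj] proj_ones by simp_all
  ultimately have "x = (\<Sum>\<alpha>\<in>internal_arcs n. c \<alpha> *\<^sub>R g_vec n e \<alpha>)"
    by (simp add: sum_wiggly_arcs)
  moreover have "{\<alpha>\<in>internal_arcs n. 0 < c \<alpha>} \<subseteq> {\<alpha>\<in>wiggly_arcs n. 0 < c \<alpha>}"
    by (auto simp: internal_arcs_def)
  then have "{\<alpha>\<in>internal_arcs n. 0 < c \<alpha>} \<in> wiggly_complex n"
    using lam pairwise_subset unfolding lamination_def wiggly_complex_def by blast
  moreover have "\<forall>\<alpha>\<in>internal_arcs n. 0 \<le> c \<alpha>"
    using lam by (simp add: lamination_def internal_arcs_def)
  ultimately show ?thesis by blast
qed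

end

section \<open>The wiggly fan\<close>

theorem theorem3p9:
  fixes n :: nat and e :: "nat \<Rightarrow> 'a::euclidean_space"
  assumes "n \<ge> 1"
    and "bij_betw e {1..2 * n} Basis"
  shows "(\<forall>D\<in>wiggly_complex n. inj_on (g_vec n e) D \<and> independent (g_vec n e ` D)) \<and>
         complete_simplicial_fan (sum_zero_hyperplane n e) (wiggly_cone n e ` wiggly_complex n)"
proof -
  interpret unique_decomposition "internal_arcs n" "g_vec n e" "wiggly_complex n"
  proof
    show "finite (internal_arcs n)" by (rule finite_internal_arcs[OF assms])
    show "D \<subseteq> internal_arcs n" if "D \<in> wiggly_complex n" for D
      using that by (simp add: wiggly_complex_def)
    show "D' \<in> wiggly_complex n" if "D \<in> wiggly_complex n" "D' \<subseteq> D" for D D'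
      using that pairwise_subset[of compatible D D'] by (auto simp: wiggly_complex_def)
  qed (rule g_decomposition_unique[OF assms])
  have "wiggly_cone n e = nonneg_span (g_vec n e)"
    by (simp add: fun_eq_iff wiggly_cone_def nonneg_span_def)
  moreover have "complete_simplicial_fan (sum_zero_hyperplane n e) (nonneg_span (g_vec n e) ` wiggly_complex n)"
    using proj_in_hyperplane[OF assms] g_decomposition_exists[OF assms] subspace_hyperplane[OF assms]
    by (intro complete_simplicial_fanI) (auto simp: g_vec_eq_proj[OF assms])
  ultimately show ?thesis using inj_on_face independent_face by simp
qed

end
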